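(* Let $\tau_L,\tau_R\in\mathbb{R}$, $\delta_L,\delta_R>0$, and let $f:\mathbb{R}^2\to\mathbb{R}^2$ be $$f(x)=\begin{cases}\begin{bmatrix}\tau_L&1\\-\delta_L&0\end{bmatrix}x+\begin{bmatrix}1\\0\end{bmatrix},&x_1\le0,\\[2mm] \begin{bmatrix}\tau_R&1\\-\delta_R&0\end{bmatrix}x+\begin{bmatrix}1\\0\end{bmatrix},&x_1\ge0.\end{cases}$$ Let $\beta>0$ and $X=(0,\beta)$, and suppose there exist $i,j\ge1$ such that $f^i(X)_1\le0$ and $f^{-j}(X)_1\ge0$. With $U,V,Y,Z$ and $\Omega$ as defined in the context, suppose that (i) $Y$ lies above $f^{-1}(U)$; (ii) $Z$ lies above the line through $f^{-1}(U)$ and $V$; (iii) $Z$ lies to the right of the line through $V$ and $f(V)$. Then $\Omega$ is forward invariant under $f$, i.e. $f(\Omega)\subseteq\Omega$. Moreover, for all $\varepsilon>0$ there exists a trapping region $\Omega_{\rm trap}\subset\Omega$ for $f$ with $d_H(\Omega,\Omega_{\rm trap})\le\varepsilon$.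
   Context: Since $\delta_L,\delta_R>0$, $f$ is a homeomorphism. Let $\Sigma=\{x\mid x_1=0\}$, so $f(\Sigma)=\{x\mid x_2=0\}$. Let $r$ be the smallest $i\ge1$ with $f^i(X)_1\le0$ and $\ell$ the smallest $j\ge1$ with $f^{-j}(X)_1\ge0$ (one has $r,\ell\ge2$). $Z=f^r(X)$; $Y$ is the intersection of the line through $Z$ and $f^{-1}(Z)$ with $\Sigma$; $V=f^{-(\ell-1)}(X)$; $U$ is the intersection of the line through $V$ and $f(V)$ with $f(\Sigma)$. The closed polygonal chain formed by connecting, in order, the points $U,f^{-(\ell-2)}(X),\dots,f^{-1}(X),X,f(X),\dots,f^{r-1}(X),Z$, and then $Z$ back to $U$, is a Jordan curve; $\Omega$ denotes this chain together with its interior. "Above" and "to the right of" are strict, with $x_2$ the vertical and $x_1$ the horizontal coordinate ($Y$ and $f^{-1}(U)$ both lie on $\Sigma$; the line in (ii) is not vertical and the line in (iii) is not horizontal). A trapping region is a compact set $\Omega_{\rm trap}$ with $f(\Omega_{\rm trap})\subseteq\mathrm{int}(\Omega_{\rm trap})$. $d_H$ is the Hausdorff distance, $d_H(\Omega_1,\Omega_2)=\max\big[\sup_{x\in\Omega_1}\inf_{y\in\Omega_2}\|x-y\|,\ \sup_{y\in\Omega_2}\inf_{x\in\Omega_1}\|x-y\|\big]$. *)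

theory Defs
  imports "HOL-Analysis.Analysis"
begin

definition affine_piece :: "real \<Rightarrow> real \<Rightarrow> real^2 \<Rightarrow> real^2" where
  "affine_piece \<tau> \<delta> x =
     (vector [vector [\<tau>, 1], vector [-\<delta>, 0]] :: real^2^2) *v x + vector [1, 0]"

definition bcnf :: "real \<Rightarrow> real \<Rightarrow> real \<Rightarrow> real \<Rightarrow> real^2 \<Rightarrow> real^2" where
  "bcnf \<tau>L \<delta>L \<tau>R \<delta>R x =
     (if x$1 \<le> 0 then affine_piece \<tau>L \<delta>L x else affine_piece \<tau>R \<delta>R x)"

lemma affine_piece_nth [simp]:
  "affine_piece \<tau> \<delta> x $ 1 = \<tau> * x$1 + x$2 + 1"
  "affine_piece \<tau> \<delta> x $ 2 = - \<delta> * x$1"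
  by (simp_all add: affine_piece_def matrix_vector_mult_def sum_2 vector_2)

text \<open>The two pieces agree on their common boundary, so the strict/non-strict
  split in the definition of the map is immaterial.\<close>

lemma bcnf_right: "x$1 \<ge> 0 \<Longrightarrow> bcnf \<tau>L \<delta>L \<tau>R \<delta>R x = affine_piece \<tau>R \<delta>R x"
  by (auto simp: bcnf_def vec_eq_iff forall_2)

text \<open>The map is bijective, so \<open>inv\<close> below is a genuine two-sided inverse.\<close>

lemma bij_bcnf:
  assumes "\<delta>L > 0" "\<delta>R > 0"
  shows "bij (bcnf \<tau>L \<delta>L \<tau>R \<delta>R)"
proof (rule bijI)
  show "inj (bcnf \<tau>L \<delta>L \<tau>R \<delta>R)"
  proof (rule injI)
    fix x y assume eq: "bcnf \<tau>L \<delta>L \<tau>R \<delta>R x = bcnf \<tau>L \<delta>L \<tau>R \<delta>R y"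
    have sgn2: "bcnf \<tau>L \<delta>L \<tau>R \<delta>R z $ 2 \<ge> 0 \<longleftrightarrow> z$1 \<le> 0" for z
      using assms by (auto simp: bcnf_def mult_le_0_iff zero_le_mult_iff)
    have "x$1 \<le> 0 \<longleftrightarrow> y$1 \<le> 0"
      using sgn2[of x] sgn2[of y] eq by simp
    then show "x = y"
      using eq assms by (auto simp: bcnf_def vec_eq_iff forall_2 split: if_splits)
  qed
  show "surj (bcnf \<tau>L \<delta>L \<tau>R \<delta>R)"
  proof (rule surjI)
    fix y :: "real^2"
    show "bcnf \<tau>L \<delta>L \<tau>R \<delta>R
       ((\<lambda>y. let a = (if y$2 \<ge> 0 then - y$2 / \<delta>L else - y$2 / \<delta>R)
             in vector [a, y$1 - 1 - (if y$2 \<ge> 0 then \<tau>L else \<tau>R) * a]) y) = y"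
      using assms
      by (auto simp: Let_def bcnf_def vec_eq_iff forall_2 vector_2 field_simps)
  qed
qed

definition switching_line :: "(real^2) set" where
  "switching_line = {x. x$1 = 0}"

definition fwd_time :: "(real^2 \<Rightarrow> real^2) \<Rightarrow> real^2 \<Rightarrow> nat" where
  "fwd_time f X = (LEAST i. i \<ge> 1 \<and> (f ^^ i) X $ 1 \<le> 0)"

definition bwd_time :: "(real^2 \<Rightarrow> real^2) \<Rightarrow> real^2 \<Rightarrow> nat" where
  "bwd_time f X = (LEAST j. j \<ge> 1 \<and> (inv f ^^ j) X $ 1 \<ge> 0)"

definition line :: "real^2 \<Rightarrow> real^2 \<Rightarrow> (real^2) set" where
  "line A B = affine hull {A, B}"

definition Z_pt :: "(real^2 \<Rightarrow> real^2) \<Rightarrow> real^2 \<Rightarrow> real^2" where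
  "Z_pt f X = (f ^^ fwd_time f X) X"

definition V_pt :: "(real^2 \<Rightarrow> real^2) \<Rightarrow> real^2 \<Rightarrow> real^2" where
  "V_pt f X = (inv f ^^ (bwd_time f X - 1)) X"

text \<open>The intersection points below are unique: minimality of the two times puts
  \<open>inv f (Z_pt f X)\<close> strictly to the right of \<open>switching_line\<close> and \<open>Z_pt f X\<close> weakly
  to its left, while \<open>f (V_pt f X)\<close> is strictly above and \<open>V_pt f X\<close> weakly below
  \<open>f ` switching_line = {x. x$2 = 0}\<close>.\<close>

lemma line_meets_axis_unique:
  fixes A B :: "real^2"
  assumes "A$i > 0" "B$i \<le> 0"
  shows "\<exists>!p. p \<in> line A B \<inter> {x. x$i = 0}"
proof
  define t where "t = A$i / (A$i - B$i)"
  have ne: "A$i - B$i \<noteq> 0" using assms by linarith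
  have "(1 - t) * A$i + t * B$i = A$i - t * (A$i - B$i)" by (simp add: algebra_simps)
  also have "\<dots> = 0" using ne by (simp add: t_def)
  finally have "(1 - t) * A$i + t * B$i = 0" .
  then show "(1 - t) *\<^sub>R A + t *\<^sub>R B \<in> line A B \<inter> {x. x$i = 0}"
    unfolding line_def affine_hull_2
    by (auto intro: exI[where x = "1 - t"] exI[where x = t])
  fix p assume "p \<in> line A B \<inter> {x. x$i = 0}"
  then obtain u v where uv: "p = u *\<^sub>R A + v *\<^sub>R B" "u + v = 1" "u * A$i + v * B$i = 0"
    by (auto simp: line_def affine_hull_2)
  have u: "u = 1 - v" using uv(2) by simp
  have "v * (A$i - B$i) = A$i" using uv(3) unfolding u by (simp add: algebra_simps)
  then have "v = t" using ne by (simp add: t_def field_simps)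
  then show "p = (1 - t) *\<^sub>R A + t *\<^sub>R B" using uv(1) u by simp
qed

definition Y_pt :: "(real^2 \<Rightarrow> real^2) \<Rightarrow> real^2 \<Rightarrow> real^2" where
  "Y_pt f X = (THE p. p \<in> line (Z_pt f X) (inv f (Z_pt f X)) \<inter> switching_line)"

definition U_pt :: "(real^2 \<Rightarrow> real^2) \<Rightarrow> real^2 \<Rightarrow> real^2" where
  "U_pt f X = (THE p. p \<in> line (V_pt f X) (f (V_pt f X)) \<inter> f ` switching_line)"

definition closed_chain :: "(real^2) list \<Rightarrow> (real^2) set" where
  "closed_chain ps =
     (\<Union>k<length ps. closed_segment (ps ! k) (ps ! (Suc k mod length ps)))"

definition \<Omega>_vertices :: "(real^2 \<Rightarrow> real^2) \<Rightarrow> real^2 \<Rightarrow> (real^2) list" where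
  "\<Omega>_vertices f X =
     [U_pt f X]
     @ map (\<lambda>j. (inv f ^^ j) X) (rev [1..<bwd_time f X - 1])
     @ map (\<lambda>i. (f ^^ i) X) [0..<fwd_time f X]
     @ [Z_pt f X]"

definition \<Omega> :: "(real^2 \<Rightarrow> real^2) \<Rightarrow> real^2 \<Rightarrow> (real^2) set" where
  "\<Omega> f X = closed_chain (\<Omega>_vertices f X) \<union> inside (closed_chain (\<Omega>_vertices f X))"

text \<open>The next two notions are used only for lines that are not vertical, respectively
  not horizontal, so the point \<open>q\<close> exists and is unique.\<close>

definition above_line :: "real^2 \<Rightarrow> (real^2) set \<Rightarrow> bool" where
  "above_line p l \<longleftrightarrow> (\<exists>q\<in>l. q$1 = p$1 \<and> p$2 > q$2)"

definition right_of_line :: "real^2 \<Rightarrow> (real^2) set \<Rightarrow> bool" where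
  "right_of_line p l \<longleftrightarrow> (\<exists>q\<in>l. q$2 = p$2 \<and> p$1 > q$1)"

definition trapping_region :: "('a::topological_space \<Rightarrow> 'a) \<Rightarrow> 'a set \<Rightarrow> bool" where
  "trapping_region f T \<longleftrightarrow> compact T \<and> f ` T \<subseteq> interior T"

text \<open>Taken in the extended reals, so that the distance between a nonempty set and
  the empty set is \<open>\<infinity>\<close>; in particular a set at finite distance from \<open>\<Omega>\<close> is nonempty.\<close>

definition hausdorff_dist :: "'a::metric_space set \<Rightarrow> 'a set \<Rightarrow> ereal" where
  "hausdorff_dist A B =
     max (SUP x\<in>A. INF y\<in>B. ereal (dist x y)) (SUP y\<in>B. INF x\<in>A. ereal (dist x y))"

end

theory Submission
  imports Defs
begin

text \<open>
  The orbit points from \<open>V\<close> to \<open>X\<close> and from \<open>X\<close> to \<open>Z\<close> form two convex arcs, because each piece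
  of the map multiplies orientations of triples by a positive constant. Hence \<open>\<Omega>\<close> is a polygon that
  is star-shaped about the origin: a fan of triangles with apex \<open>0\<close>. A piece of the map is affine on
  each triangle, once the triangle crossing the switching line is cut at \<open>Y\<close>, so only images of
  vertices have to be located. Conditions (ii) and (iii) put \<open>f Z\<close> in the interior, and (i) does the
  same for \<open>f Y\<close>; every other boundary point is moved along the boundary and enters the interior
  after a bounded number \<open>n\<close> of steps. A compact set with \<open>f \<Omega> \<subseteq> \<Omega>\<close> and
  \<open>f\<^sup>n \<Omega> \<subseteq> interior \<Omega>\<close> that is the closure of its interior contains trapping regions
  arbitrarily close to it.
\<close>

text \<open>The obstacle is that \<open>f\<close> carries much of the boundary into the boundary, so
  containment has to be tracked in a weak and a strict form, and one application of \<open>f\<close>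
  does not reach the interior. Moreover the corner at \<open>Z\<close> may be reflex, so a single
  system of half planes cannot describe the polygon. The cuts used instead are adapted to
  \<open>f\<close>: the second coordinate of \<open>f x\<close> is a negative multiple of the first
  coordinate of \<open>x\<close>, so the left half plane lands in the upper one, where only the
  edges from \<open>U\<close> to \<open>f X\<close> bound the polygon, and the right half plane
  lands in the lower one. The apex is sent to (1,0), which lies strictly inside. \<open>U\<close>
  stands in for \<open>V\<close> because \<open>f U\<close> still lies on the edge from
  \<open>f V\<close> to \<open>f (f V)\<close>.\<close>

section \<open>Orientation of triples in the plane\<close>

text \<open>Twice the signed area of the triangle. Polygons are traversed clockwise below, so a
  negative value means that \<open>c\<close> is on the inner side of the edge from \<open>a\<close>
  to \<open>b\<close>.\<close>

definition orient :: "real^2 \<Rightarrow> real^2 \<Rightarrow> real^2 \<Rightarrow> real" where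
  "orient a b c = (b$1 - a$1) * (c$2 - a$2) - (b$2 - a$2) * (c$1 - a$1)"

lemma orient_degenerate [simp]: "orient a b a = 0" "orient a b b = 0" "orient a a c = 0"
  by (simp_all add: orient_def algebra_simps)

text \<open>The map is affine, not linear, in its last argument; the origin takes up the missing
  weight.\<close>

lemma orient_lincomb:
  "orient a b (s *\<^sub>R x + t *\<^sub>R y) =
     (1 - s - t) * orient a b 0 + s * orient a b x + t * orient a b y"
  by (simp add: orient_def algebra_simps)

lemma orient_convex3:
  "orient a b ((1 - s - t) *\<^sub>R z + s *\<^sub>R x + t *\<^sub>R y) =
     (1 - s - t) * orient a b z + s * orient a b x + t * orient a b y"
  by (simp add: orient_def algebra_simps)

lemma orient_convex2:
  "orient a b ((1 - t) *\<^sub>R x + t *\<^sub>R y) = (1 - t) * orient a b x + t * orient a b y"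
  by (simp add: orient_def algebra_simps)

lemma orient_scale:
  "orient a b (c *\<^sub>R x) = (1 - c) * orient a b 0 + c * orient a b x"
  by (simp add: orient_def algebra_simps)

lemma orient_0: "orient a b 0 = a$1 * b$2 - a$2 * b$1"
  by (simp add: orient_def algebra_simps)

text \<open>The two identities are the Pluecker relation \<open>(u \<times> v) w + (v \<times> w) u + (w \<times> u) v = 0\<close>
  for vectors of the plane, read off in the second coordinate.\<close>

lemma orient_pluecker_step:
  "orient b c w * (a$2 - b$2) = orient a b c * (w$2 - b$2) + orient a b w * (b$2 - c$2)"
  by (simp add: orient_def algebra_simps)

lemma orient_pluecker_cross:
  "orient a b d * (c$2 - a$2) = orient c d a * (b$2 - a$2) + orient a b c * (d$2 - a$2)"
  by (simp add: orient_def algebra_simps)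

section \<open>Convexity of an affine orbit arc\<close>

text \<open>Models the left arc: \<open>p 0\<close> is \<open>V\<close>, \<open>p M\<close> is
  \<open>X\<close> and \<open>p (Suc M)\<close> is \<open>f X\<close>. The point after that is
  obtained by continuing with the same affine map \<open>g\<close> beyond its half plane, so it need
  not belong to the orbit of the piecewise map; it only serves to measure the turn.\<close>

locale affine_arc =
  fixes g :: "real^2 \<Rightarrow> real^2" and p :: "nat \<Rightarrow> real^2" and M :: nat and \<kappa> :: real
  assumes scale: "\<And>a b c. orient (g a) (g b) (g c) = \<kappa> * orient a b c"
    and \<kappa>: "\<kappa> > 0"
    and step: "\<And>k. p (Suc k) = g (p k)"
    and M: "M \<ge> 1"
    and start: "p 0 $ 1 < 0" "p 0 $ 2 \<le> 0"
    and upper: "\<And>k. 1 \<le> k \<Longrightarrow> k \<le> M \<Longrightarrow> p k $ 2 > 0"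
    and top: "p M $ 1 = 0"
    and right: "p (Suc M) $ 1 > 0" "p (Suc M) $ 2 = 0"
    and below: "p (Suc (Suc M)) $ 2 < 0"
begin

text \<open>Signs depend only on index differences, so any edge can be moved to the last or to the
  first one.\<close>

lemma shift:
  "orient (p (i + k)) (p (Suc (i + k))) (p (j + k)) = \<kappa> ^ k * orient (p i) (p (Suc i)) (p j)"
  by (induction k) (simp_all add: step scale mult.assoc)

lemma last_edge_start: "orient (p M) (p (Suc M)) (p 0) < 0"
proof -
  have "orient (p M) (p (Suc M)) (p 0)
      = p (Suc M) $ 1 * (p 0 $ 2 - p M $ 2) + p M $ 2 * p 0 $ 1"
    by (simp add: orient_def right top algebra_simps)
  moreover have "p (Suc M) $ 1 * (p 0 $ 2 - p M $ 2) < 0"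
    using right upper[of M] M start by (intro mult_pos_neg) auto
  moreover have "p M $ 2 * p 0 $ 1 < 0"
    using upper[of M] M start by (intro mult_pos_neg) auto
  ultimately show ?thesis by linarith
qed

text \<open>A backward recursion for the side of the last edge on which orbit points lie: for points
  above the axis both weights are positive, so the side is inherited from \<open>Suc j\<close> by
  \<open>j\<close> once the turn is known.\<close>

lemma last_edge_pred:
  "\<kappa> * orient (p M) (p (Suc M)) (p j) * p M $ 2 =
     orient (p M) (p (Suc M)) (p (Suc (Suc M))) * p (Suc j) $ 2
     + orient (p M) (p (Suc M)) (p (Suc j)) * (- p (Suc (Suc M)) $ 2)"
  using orient_pluecker_step[of "p (Suc M)" "p (Suc (Suc M))" "p (Suc j)" "p M"]
    shift[of M 1 j] by (simp add: right)

text \<open>If the arc turned to the left, the orbit followed backwards from \<open>p M\<close> would stay on the left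
  of the last edge and could not reach the third quadrant.\<close>

lemma turn: "orient (p M) (p (Suc M)) (p (Suc (Suc M))) < 0"
proof (rule ccontr)
  assume C: "\<not> ?thesis"
  have pM: "p M $ 2 > 0" using upper[of M] M by simp
  have "orient (p M) (p (Suc M)) (p (M - j)) \<ge> 0" if "j \<le> M" for j
    using that
  proof (induction j)
    case (Suc j)
    then have s: "Suc (M - Suc j) = M - j" by simp
    have "p (M - j) $ 2 > 0" using upper[of "M - j"] Suc.prems by simp
    then have "0 \<le> \<kappa> * orient (p M) (p (Suc M)) (p (M - Suc j)) * p M $ 2"
      unfolding last_edge_pred s using C Suc below
      by (intro add_nonneg_nonneg mult_nonneg_nonneg) auto
    then show ?case using \<kappa> pM by (simp add: zero_le_mult_iff)
  qed simp
  from this[of M] last_edge_start show False by simp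
qed

lemma last_edge:
  assumes "j < M"
  shows "orient (p M) (p (Suc M)) (p j) < 0"
proof -
  have pM: "p M $ 2 > 0" using upper[of M] M by simp
  have "orient (p M) (p (Suc M)) (p (M - Suc j)) < 0" if "Suc j \<le> M" for j
    using that
  proof (induction j)
    case 0
    then have s: "Suc (M - Suc 0) = M" by simp
    have "0 > \<kappa> * orient (p M) (p (Suc M)) (p (M - Suc 0)) * p M $ 2"
      unfolding last_edge_pred s using turn pM by (simp add: mult_neg_pos)
    then show ?case using \<kappa> pM by (simp add: mult_less_0_iff zero_less_mult_iff)
  next
    case (Suc j)
    then have s: "Suc (M - Suc (Suc j)) = M - Suc j" by simp
    have "0 > \<kappa> * orient (p M) (p (Suc M)) (p (M - Suc (Suc j))) * p M $ 2"
      unfolding last_edge_pred s using turn Suc upper[of "M - Suc j"] below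
      by (intro add_neg_neg mult_neg_pos) auto
    then show ?case using \<kappa> pM by (simp add: mult_less_0_iff zero_less_mult_iff)
  qed
  from this[of "M - Suc j"] assms show ?thesis by simp
qed

text \<open>Shifting by \<open>M - i\<close> turns the edge into the last one and keeps
  \<open>j\<close> within range.\<close>

lemma edge_before:
  assumes "j < i" "i \<le> M"
  shows "orient (p i) (p (Suc i)) (p j) < 0"
  using shift[of i "M - i" j] last_edge[of "j + (M - i)"] assms \<kappa>
  by (simp add: mult_less_0_iff)

text \<open>Points that come after an edge would leave the arc under a forward shift, so they are
  treated from the first edge instead. The base case is the turn shifted back by \<open>M\<close>;
  the step crosses the new edge, for which \<open>p 0\<close> is an earlier point.\<close>

lemma first_edge:
  assumes "2 \<le> j" "j \<le> Suc M"
  shows "orient (p 0) (p 1) (p j) < 0"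
  using assms
proof (induction j rule: dec_induct)
  case base
  show ?case using shift[of 0 M 2] turn \<kappa> by (simp add: mult_less_0_iff)
next
  case (step n)
  have n: "p n $ 2 > 0" using step upper by simp
  have s: "p (Suc n) $ 2 \<ge> 0" using step upper[of "Suc n"] right by (cases "n = M") auto
  have "orient (p 0) (p 1) (p (Suc n)) * (p n $ 2 - p 0 $ 2) < 0"
    unfolding orient_pluecker_cross[of _ _ _ "p n"]
    using edge_before[of 0 n] step n s start upper[of 1] M
    by (intro add_neg_nonpos mult_neg_pos mult_nonpos_nonneg) auto
  then show ?case using n start by (simp add: mult_less_0_iff)
qed

lemma edge_point:
  assumes "i \<le> M" "j \<le> Suc M" "j \<noteq> i" "j \<noteq> Suc i"
  shows "orient (p i) (p (Suc i)) (p j) < 0"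
proof (cases "j < i")
  case False
  then show ?thesis using shift[of 0 i "j - i"] first_edge[of "j - i"] assms \<kappa>
    by (simp add: mult_pos_neg)
qed (use assms edge_before in auto)

lemma edge_point_le:
  assumes "i \<le> M" "j \<le> Suc M"
  shows "orient (p i) (p (Suc i)) (p j) \<le> 0"
  using edge_point[of i j] assms by (cases "j = i \<or> j = Suc i") (auto simp: less_imp_le)

text \<open>The origin is a convex combination of \<open>p 0\<close>, \<open>p M\<close> and \<open>p (Suc M)\<close>.\<close>

lemma edge_0:
  assumes "i \<le> M"
  shows "orient (p i) (p (Suc i)) 0 < 0"
proof -
  define s where "s = - p 0 $ 2 / p M $ 2"
  define t where "t = - p 0 $ 1 / p (Suc M) $ 1"
  have pM: "p M $ 2 > 0" using upper[of M] M by simp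
  have st: "s \<ge> 0" "t > 0"
    using pM start right by (simp_all add: s_def t_def divide_nonpos_pos divide_neg_pos)
  have "p 0 + s *\<^sub>R p M + t *\<^sub>R p (Suc M) = 0"
    using pM right top by (simp add: vec_eq_iff forall_2 s_def t_def)
  then have "orient (p i) (p (Suc i)) 0 * (1 + s + t) =
      orient (p i) (p (Suc i)) (p 0) + s * orient (p i) (p (Suc i)) (p M)
      + t * orient (p i) (p (Suc i)) (p (Suc M))"
    by (simp add: orient_def vec_eq_iff forall_2) algebra
  moreover have "orient (p i) (p (Suc i)) (p 0) < 0 \<or> orient (p i) (p (Suc i)) (p (Suc M)) < 0"
    using edge_point[of i 0] edge_point[of i "Suc M"] assms M by (cases i) auto
  moreover have "s * orient (p i) (p (Suc i)) (p M) \<le> 0"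
    using st edge_point_le[of i M] assms by (simp add: mult_nonneg_nonpos)
  moreover have "t * orient (p i) (p (Suc i)) (p (Suc M)) \<le> 0"
    using st edge_point_le[of i "Suc M"] assms by (simp add: mult_nonneg_nonpos)
  moreover have "t * orient (p i) (p (Suc i)) (p (Suc M)) < 0" 
    if "orient (p i) (p (Suc i)) (p (Suc M)) < 0"
    using st that by (simp add: mult_pos_neg)
  ultimately have "orient (p i) (p (Suc i)) 0 * (1 + s + t) < 0"
    using edge_point_le[of i 0] assms by fastforce
  then show ?thesis using st by (simp add: mult_less_0_iff)
qed

end

section \<open>Star-shaped polygons as fans of cones\<close>

text \<open>Cramer's rule: \<open>orient a b 0\<close> is the determinant with columns
  \<open>a\<close> and \<open>b\<close>.\<close>

lemma cone_decomposition:
  assumes "orient a b 0 < 0" "orient a w 0 \<le> 0" "orient b w 0 \<ge> 0"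
  obtains s t where "s \<ge> 0" "t \<ge> 0" "w = s *\<^sub>R a + t *\<^sub>R b"
proof
  show "orient b w 0 / - orient a b 0 \<ge> 0" "orient a w 0 / orient a b 0 \<ge> 0"
    using assms by (auto simp: divide_nonneg_neg divide_nonpos_neg)
  have "orient a b 0 *\<^sub>R w = (- orient b w 0) *\<^sub>R a + orient a w 0 *\<^sub>R b"
    by (simp add: vec_eq_iff forall_2 orient_0 algebra_simps)
  then have "w = (1 / orient a b 0) *\<^sub>R ((- orient b w 0) *\<^sub>R a + orient a w 0 *\<^sub>R b)"
    using assms(1) by (metis divide_inverse mult_1 order_less_irrefl real_vector_eq_affinity
        scaleR_one scaleR_scaleR left_inverse)
  then show "w = (orient b w 0 / - orient a b 0) *\<^sub>R a + (orient a w 0 / orient a b 0) *\<^sub>R b"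
    by (simp add: scaleR_diff_right)
qed

text \<open>A discrete intermediate value argument: the sign of \<open>orient (p k) w 0\<close> has
  to change across some consecutive pair of rays, and \<open>w\<close> lies in the cone between
  them.\<close>

lemma fan_decomposition:
  assumes "i < j" "\<And>k. i \<le> k \<Longrightarrow> k < j \<Longrightarrow> orient (p k) (p (Suc k)) 0 < 0"
    and "orient (p i) w 0 \<le> 0" "orient (p j) w 0 \<ge> 0"
  shows "\<exists>k s t. i \<le> k \<and> k < j \<and> s \<ge> 0 \<and> t \<ge> 0 \<and> w = s *\<^sub>R p k + t *\<^sub>R p (Suc k)"
  using assms
proof (induction j)
  case (Suc j)
  show ?case
  proof (cases "i < j \<and> orient (p j) w 0 \<ge> 0")
    case True
    then show ?thesis using Suc.IH Suc.prems by (metis less_Suc_eq)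
  next
    case False
    then have "orient (p j) w 0 \<le> 0"
      using Suc.prems by (cases "i = j") auto
    then obtain s t where "s \<ge> 0" "t \<ge> 0" "w = s *\<^sub>R p j + t *\<^sub>R p (Suc j)"
      using cone_decomposition[of "p j" "p (Suc j)" w] Suc.prems by auto
    then show ?thesis using Suc.prems(1) by (intro exI[of _ j] exI[of _ s] exI[of _ t]) auto
  qed
qed simp

text \<open>The polygon is described by half planes in each of three sectors: the upper half plane,
  the part of the lower half plane to the right of the ray through \<open>p N\<close>, and the part to its left.
  It need not be convex at \<open>p N\<close>.\<close>

locale fan_polygon =
  fixes p :: "nat \<Rightarrow> real^2" and m N :: nat
  assumes m: "Suc m < N"
    and left: "p 0 $ 1 < 0" "p 0 $ 2 = 0" "p (Suc N) = p 0"
    and right: "p (Suc m) $ 1 > 0" "p (Suc m) $ 2 = 0"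
    and bottom: "p N $ 1 \<le> 0" "p N $ 2 < 0"
    and origin: "\<And>i. i \<le> N \<Longrightarrow> orient (p i) (p (Suc i)) 0 < 0"
    and upper_edges: "\<And>i j. i \<le> m \<Longrightarrow> j \<le> Suc m \<Longrightarrow> orient (p i) (p (Suc i)) (p j) \<le> 0"
    and lower_edges: "\<And>i j. m < i \<Longrightarrow> i < N \<Longrightarrow> m < j \<Longrightarrow> j \<le> N \<Longrightarrow>
      orient (p i) (p (Suc i)) (p j) \<le> 0"
    and upper_points: "\<And>j. j \<le> Suc m \<Longrightarrow> p j $ 2 \<ge> 0"
    and lower_points: "\<And>j. m < j \<Longrightarrow> j \<le> N \<Longrightarrow> p j $ 2 \<le> 0"
    and lower_points': "\<And>j. m < j \<Longrightarrow> j \<le> N \<Longrightarrow> orient (p j) (p N) 0 \<le> 0"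
begin

definition edge :: "nat \<Rightarrow> real^2 \<Rightarrow> real" where
  "edge i w = orient (p i) (p (Suc i)) w"

text \<open>The relation is a parameter so that \<open>\<le>\<close> gives the closed polygon and
  \<open><\<close> an open set inside it by the same proofs. The sectors are closed and overlap in
  rays, where the conditions of both neighbours are imposed.\<close>

definition region :: "(real \<Rightarrow> real \<Rightarrow> bool) \<Rightarrow> (real^2) set" where
  "region R = {w. (w$2 \<ge> 0 \<longrightarrow> (\<forall>i\<le>m. R (edge i w) 0)) \<and>
     (w$2 \<le> 0 \<and> orient w (p N) 0 \<le> 0 \<longrightarrow> (\<forall>i. m < i \<and> i < N \<longrightarrow> R (edge i w) 0)) \<and>
     (w$2 \<le> 0 \<and> orient w (p N) 0 \<ge> 0 \<longrightarrow> R (edge N w) 0)}"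

definition order_rel :: "(real \<Rightarrow> real \<Rightarrow> bool) \<Rightarrow> bool" where
  "order_rel R \<longleftrightarrow> R = (\<le>) \<or> R = (<)"

lemma order_rel_simps [simp]: "order_rel (\<le>)" "order_rel (<)"
  by (simp_all add: order_rel_def)

text \<open>Both end points lie on the edge, so only the contribution of the origin survives, and
  its sign is known.\<close>

lemma edge_cone:
  assumes "i \<le> N"
  shows "edge i (s *\<^sub>R p i + t *\<^sub>R p (Suc i)) = (1 - s - t) * edge i 0"
  by (simp add: edge_def orient_lincomb)

lemma edge_cone_iff:
  assumes "order_rel R" "i \<le> N"
  shows "R (edge i (s *\<^sub>R p i + t *\<^sub>R p (Suc i))) 0 \<longleftrightarrow> R (s + t) 1"
  using assms origin[of i] unfolding edge_cone[OF assms(2)] order_rel_def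
  by (auto simp: edge_def mult_le_0_iff mult_less_0_iff)

lemma edge_triangle:
  assumes "order_rel R" "i \<le> N" "s \<ge> 0" "t \<ge> 0" "R (s + t) 1" "edge i x \<le> 0" "edge i y \<le> 0"
  shows "R (edge i (s *\<^sub>R x + t *\<^sub>R y)) 0"
proof -
  have "R ((1 - s - t) * edge i 0) 0"
    using assms origin[of i]
    by (auto simp: order_rel_def edge_def mult_le_0_iff mult_less_0_iff)
  moreover have "s * edge i x \<le> 0" "t * edge i y \<le> 0"
    using assms by (simp_all add: mult_nonneg_nonpos)
  ultimately show ?thesis
    using assms(1) unfolding edge_def orient_lincomb order_rel_def by auto
qed

lemma edge_ray:
  assumes "order_rel R" "i \<le> N" "c \<ge> 0" "R c 1" "edge i x \<le> 0"
  shows "R (edge i (c *\<^sub>R x)) 0"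
  using edge_triangle[of R i c 0 x x] assms by simp

lemma edge_self [simp]: "edge i (p i) = 0" "edge i (p (Suc i)) = 0"
  by (simp_all add: edge_def)

lemma ray_iff:
  assumes "order_rel R" "i \<le> N"
  shows "R (edge i (c *\<^sub>R p i)) 0 \<longleftrightarrow> R c 1" "R (edge i (c *\<^sub>R p (Suc i))) 0 \<longleftrightarrow> R c 1"
  using edge_cone_iff[OF assms, of c 0] edge_cone_iff[OF assms, of 0 c] by simp_all

lemma right_axis:
  assumes "w$2 = 0" "w$1 \<ge> 0"
  obtains c where "c \<ge> 0" "w = c *\<^sub>R p (Suc m)"
proof
  show "w$1 / p (Suc m) $ 1 \<ge> 0" using assms right by simp
  show "w = (w$1 / p (Suc m) $ 1) *\<^sub>R p (Suc m)"
    using assms right by (simp add: vec_eq_iff forall_2)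
qed

lemma left_axis:
  assumes "w$2 = 0" "w$1 \<le> 0"
  obtains c where "c \<ge> 0" "w = c *\<^sub>R p 0"
proof
  show "w$1 / p 0 $ 1 \<ge> 0" using assms left by (simp add: divide_nonpos_neg)
  show "w = (w$1 / p 0 $ 1) *\<^sub>R p 0"
    using assms left by (simp add: vec_eq_iff forall_2)
qed

lemma bottom_ray:
  assumes "w$2 \<le> 0" "orient w (p N) 0 = 0"
  obtains c where "c \<ge> 0" "w = c *\<^sub>R p N"
proof
  show "w$2 / p N $ 2 \<ge> 0" using assms bottom by (simp add: divide_nonpos_neg)
  show "w = (w$2 / p N $ 2) *\<^sub>R p N"
    using assms bottom by (simp add: vec_eq_iff forall_2 orient_0 field_simps)
qed

lemma axis_sector:
  assumes "w$2 = 0"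
  shows "orient w (p N) 0 \<le> 0 \<longleftrightarrow> w$1 \<ge> 0" "orient w (p N) 0 \<ge> 0 \<longleftrightarrow> w$1 \<le> 0"
  using assms bottom by (auto simp: orient_0 mult_le_0_iff zero_le_mult_iff)

text \<open>On a ray shared by two sectors either system of inequalities amounts to
  \<open>R c 1\<close>. This agreement, here and on the other two rays, makes the sector
  descriptions compatible.\<close>

lemma right_axis_iff:
  assumes R: "order_rel R" and c: "c \<ge> 0"
  shows "(\<forall>i\<le>m. R (edge i (c *\<^sub>R p (Suc m))) 0) \<longleftrightarrow> R c 1"
    and "(\<forall>i. m < i \<and> i < N \<longrightarrow> R (edge i (c *\<^sub>R p (Suc m))) 0) \<longleftrightarrow> R c 1"
  using ray_iff[OF R, of m c] ray_iff[OF R, of "Suc m" c] m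
    edge_ray[OF R _ c] upper_edges[of _ "Suc m"] lower_edges[of _ "Suc m"]
  by (auto simp: edge_def)

lemma left_axis_iff:
  assumes R: "order_rel R" and c: "c \<ge> 0"
  shows "(\<forall>i\<le>m. R (edge i (c *\<^sub>R p 0)) 0) \<longleftrightarrow> R c 1"
    and "R (edge N (c *\<^sub>R p 0)) 0 \<longleftrightarrow> R c 1"
  using ray_iff[OF R, of 0 c] ray_iff[OF R, of N c] m edge_ray[OF R _ c] upper_edges[of _ 0] left
  by (auto simp: edge_def)

lemma bottom_ray_iff:
  assumes R: "order_rel R" and c: "c \<ge> 0"
  shows "(\<forall>i. m < i \<and> i < N \<longrightarrow> R (edge i (c *\<^sub>R p N)) 0) \<longleftrightarrow> R c 1"
    and "R (edge N (c *\<^sub>R p N)) 0 \<longleftrightarrow> R c 1"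
proof -
  \<comment> \<open>The lower right sector needs an edge that ends at \<open>p N\<close>; it is the
    one with index \<open>N - 1\<close>.\<close>
  have "m < N - 1" "N - 1 < N" "Suc (N - 1) = N" using m by auto
  then show "(\<forall>i. m < i \<and> i < N \<longrightarrow> R (edge i (c *\<^sub>R p N)) 0) \<longleftrightarrow> R c 1"
    using ray_iff(2)[OF R, of "N - 1" c] edge_ray[OF R _ c] lower_edges[of _ N]
    by (metis edge_def le_refl less_imp_le less_trans)
  show "R (edge N (c *\<^sub>R p N)) 0 \<longleftrightarrow> R c 1"
    using ray_iff(1)[OF R] by simp
qed

text \<open>Since neighbouring descriptions agree on shared rays, one sector decides membership even
  on its own boundary.\<close>

lemma region_upper_iff:
  assumes "order_rel R" "w$2 \<ge> 0"
  shows "w \<in> region R \<longleftrightarrow> (\<forall>i\<le>m. R (edge i w) 0)"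
proof (cases "w$2 = 0")
  case True
  show ?thesis
  proof (cases "w$1 \<ge> 0")
    case T: True
    with True obtain c where c: "c \<ge> 0" "w = c *\<^sub>R p (Suc m)" by (rule right_axis)
    \<comment> \<open>On the right half axis the left sector is met only at the origin, where every
      edge is strictly negative.\<close>
    have "w$1 \<le> 0 \<Longrightarrow> w = 0" using T True by (simp add: vec_eq_iff forall_2)
    moreover have "R (edge i 0) 0" if "i \<le> N" for i
      using assms(1) origin[OF that] by (auto simp: order_rel_def edge_def)
    ultimately show ?thesis
      using right_axis_iff[OF assms(1) c(1)] True T m unfolding region_def
      by (auto simp: axis_sector c(2)[symmetric])
  next
    case F: False
    then obtain c where c: "c \<ge> 0" "w = c *\<^sub>R p 0" using left_axis[of w] True by auto
    show ?thesis
      using left_axis_iff[OF assms(1) c(1)] True F unfolding region_def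
      by (auto simp: axis_sector c(2)[symmetric])
  qed
qed (use assms in \<open>auto simp: region_def\<close>)

lemma region_lower_iff:
  assumes "order_rel R" "w$2 \<le> 0" "orient w (p N) 0 \<le> 0"
  shows "w \<in> region R \<longleftrightarrow> (\<forall>i. m < i \<and> i < N \<longrightarrow> R (edge i w) 0)"
proof (cases "w$2 = 0")
  case True
  then have "w$1 \<ge> 0" using assms axis_sector by simp
  with True obtain c where c: "c \<ge> 0" "w = c *\<^sub>R p (Suc m)" by (rule right_axis)
  show ?thesis
    using right_axis_iff[OF assms(1) c(1)] region_upper_iff[OF assms(1), of w] True
    by (simp add: c(2)[symmetric])
next
  case False
  show ?thesis
  proof (cases "orient w (p N) 0 = 0")
    case True
    then obtain c where c: "c \<ge> 0" "w = c *\<^sub>R p N" using bottom_ray assms by blast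
    show ?thesis
      using bottom_ray_iff[OF assms(1) c(1)] True False assms unfolding region_def
      by (auto simp: c(2)[symmetric])
  qed (use False assms in \<open>auto simp: region_def\<close>)
qed

lemma region_left_iff:
  assumes "order_rel R" "w$2 \<le> 0" "orient w (p N) 0 \<ge> 0"
  shows "w \<in> region R \<longleftrightarrow> R (edge N w) 0"
proof (cases "orient w (p N) 0 = 0")
  case True
  then obtain c where c: "c \<ge> 0" "w = c *\<^sub>R p N" using bottom_ray assms by blast
  show ?thesis
    using bottom_ray_iff[OF assms(1) c(1)] region_lower_iff[OF assms(1), of w] True assms(2)
    by (simp add: c(2)[symmetric])
next
  case False
  show ?thesis
  proof (cases "w$2 = 0")
    case True
    then have "w$1 \<le> 0" using assms axis_sector by simp
    with True obtain c where c: "c \<ge> 0" "w = c *\<^sub>R p 0" by (rule left_axis)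
    show ?thesis
      using left_axis_iff[OF assms(1) c(1)] region_upper_iff[OF assms(1), of w] True
      by (simp add: c(2)[symmetric])
  qed (use False assms in \<open>auto simp: region_def\<close>)
qed

lemma cone_upper:
  assumes "k \<le> m" "s \<ge> 0" "t \<ge> 0"
  shows "(s *\<^sub>R p k + t *\<^sub>R p (Suc k)) $ 2 \<ge> 0"
  using assms upper_points by simp

lemma cone_lower:
  assumes "m < k" "k < N" "s \<ge> 0" "t \<ge> 0"
  shows "(s *\<^sub>R p k + t *\<^sub>R p (Suc k)) $ 2 \<le> 0"
    and "orient (s *\<^sub>R p k + t *\<^sub>R p (Suc k)) (p N) 0 \<le> 0"
proof -
  show "(s *\<^sub>R p k + t *\<^sub>R p (Suc k)) $ 2 \<le> 0"
    using assms lower_points by (simp add: add_nonpos_nonpos mult_nonneg_nonpos)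
  have "orient (s *\<^sub>R p k + t *\<^sub>R p (Suc k)) (p N) 0
      = s * orient (p k) (p N) 0 + t * orient (p (Suc k)) (p N) 0"
    by (simp add: orient_0 algebra_simps)
  then show "orient (s *\<^sub>R p k + t *\<^sub>R p (Suc k)) (p N) 0 \<le> 0"
    using assms lower_points' by (simp add: add_nonpos_nonpos mult_nonneg_nonpos)
qed

lemma cone_left:
  assumes "s \<ge> 0" "t \<ge> 0"
  shows "(s *\<^sub>R p N + t *\<^sub>R p (Suc N)) $ 2 \<le> 0"
    and "orient (s *\<^sub>R p N + t *\<^sub>R p (Suc N)) (p N) 0 \<ge> 0"
  using assms left bottom
  by (auto simp: orient_0 algebra_simps mult_nonneg_nonpos mult_nonneg_nonneg mult_nonpos_nonpos)

lemma sector_cases: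
  assumes "k \<le> N"
  obtains "k \<le> m" | "m < k" "k < N" | "k = N"
  using assms by linarith

text \<open>The bridge between half planes and fan triangles. The edge of the cone itself yields
  exactly the bound on \<open>s + t\<close>; the other edges of the sector follow, since 0 and both
  end points satisfy them.\<close>

lemma cone_region_iff:
  assumes R: "order_rel R" and k: "k \<le> N" and st: "s \<ge> 0" "t \<ge> 0"
  shows "s *\<^sub>R p k + t *\<^sub>R p (Suc k) \<in> region R \<longleftrightarrow> R (s + t) 1"
  using k
proof (cases rule: sector_cases)
  case 1
  then show ?thesis
    unfolding region_upper_iff[OF R cone_upper[OF 1 st]]
    using edge_cone_iff[OF R k] edge_triangle[OF R _ st] upper_edges m
    by (auto simp: edge_def)
next
  case 2
  then show ?thesis
    unfolding region_lower_iff[OF R cone_lower[OF 2 st]]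
    using edge_cone_iff[OF R k] edge_triangle[OF R _ st] lower_edges
    by (auto simp: edge_def)
next
  case 3
  show ?thesis
    unfolding 3 region_left_iff[OF R cone_left[OF st]] by (rule edge_cone_iff[OF R]) simp
qed

text \<open>Signs of cross products locate a ray only within at most a half turn, so the fan is
  searched sector by sector.\<close>

lemma cone_exists:
  obtains k s t where "k \<le> N" "s \<ge> 0" "t \<ge> 0" "w = s *\<^sub>R p k + t *\<^sub>R p (Suc k)"
proof -
  have "\<exists>k s t. k < Suc N \<and> s \<ge> 0 \<and> t \<ge> 0 \<and> w = s *\<^sub>R p k + t *\<^sub>R p (Suc k)"
  proof (cases "w$2 \<ge> 0")
    case True
    then have "orient (p 0) w 0 \<le> 0" "orient (p (Suc m)) w 0 \<ge> 0"
      using left right by (auto simp: orient_0 mult_nonpos_nonneg)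
    then obtain k s t where "k < Suc m" "s \<ge> 0" "t \<ge> 0" "w = s *\<^sub>R p k + t *\<^sub>R p (Suc k)"
      using fan_decomposition[of 0 "Suc m" p w] origin m by auto
    then show ?thesis using m by (intro exI[of _ k] exI[of _ s] exI[of _ t]) auto
  next
    case F: False
    show ?thesis
    proof (cases "orient w (p N) 0 \<le> 0")
      case True
      then have "orient (p (Suc m)) w 0 \<le> 0" "orient (p N) w 0 \<ge> 0"
        using F right by (auto simp: orient_0 mult_nonpos_nonneg mult.commute)
      then obtain k s t where "k < N" "s \<ge> 0" "t \<ge> 0" "w = s *\<^sub>R p k + t *\<^sub>R p (Suc k)"
        using fan_decomposition[of "Suc m" N p w] origin m by auto
      then show ?thesis using m by (intro exI[of _ k] exI[of _ s] exI[of _ t]) auto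
    next
      case False
      then have "orient (p N) w 0 \<le> 0" "orient (p (Suc N)) w 0 \<ge> 0"
        using F left by (auto simp: orient_0 mult_nonpos_nonpos algebra_simps)
      then obtain k s t where "k < Suc N" "s \<ge> 0" "t \<ge> 0" "w = s *\<^sub>R p k + t *\<^sub>R p (Suc k)"
        using fan_decomposition[of N "Suc N" p w] origin m by auto
      then show ?thesis using m by (intro exI[of _ k] exI[of _ s] exI[of _ t]) auto
    qed
  qed
  then show ?thesis using that by (metis less_Suc_eq_le)
qed

lemma region_cone:
  assumes "order_rel R" "w \<in> region R"
  obtains k s t where "k \<le> N" "s \<ge> 0" "t \<ge> 0" "w = s *\<^sub>R p k + t *\<^sub>R p (Suc k)" "R (s + t) 1"
proof -
  obtain k s t where c: "k \<le> N" "s \<ge> 0" "t \<ge> 0" "w = s *\<^sub>R p k + t *\<^sub>R p (Suc k)"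
    by (rule cone_exists)
  then show ?thesis using that assms cone_region_iff by metis
qed

definition chain :: "(real^2) set" where
  "chain = (\<Union>k\<le>N. closed_segment (p k) (p (Suc k)))"

text \<open>Strict star-shapedness: shrinking towards the origin multiplies \<open>s + t\<close> by
  \<open>c\<close>. It yields both the density of the open part and the escape of outer rays to
  infinity.\<close>

lemma region_scaled:
  assumes "w \<in> region (\<le>)" "0 \<le> c" "c \<le> 1"
  shows "c *\<^sub>R w \<in> region (\<le>)" and "c < 1 \<Longrightarrow> c *\<^sub>R w \<in> region (<)"
proof -
  obtain k s t where k: "k \<le> N" "s \<ge> 0" "t \<ge> 0" "w = s *\<^sub>R p k + t *\<^sub>R p (Suc k)" "s + t \<le> 1"
    using region_cone[OF _ assms(1)] by auto
  have w: "c *\<^sub>R w = (c * s) *\<^sub>R p k + (c * t) *\<^sub>R p (Suc k)"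
    by (simp add: k scaleR_add_right)
  have le: "c * (s + t) \<le> c * 1" using k assms by (intro mult_left_mono) auto
  show "c *\<^sub>R w \<in> region (\<le>)"
    unfolding w using k assms le by (subst cone_region_iff) (auto simp: algebra_simps)
  show "c *\<^sub>R w \<in> region (<)" if "c < 1"
    unfolding w using k assms le that by (subst cone_region_iff) (auto simp: algebra_simps)
qed

lemma chain_subset_region: "chain \<subseteq> region (\<le>)"
proof
  fix w assume "w \<in> chain"
  then obtain k u where k: "k \<le> N" "0 \<le> u" "u \<le> 1" "w = (1 - u) *\<^sub>R p k + u *\<^sub>R p (Suc k)"
    by (auto simp: chain_def in_segment)
  then show "w \<in> region (\<le>)" using cone_region_iff[of "(\<le>)" k "1 - u" u] by simp
qed

lemma region_cases:
  assumes "w \<in> region (\<le>)"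
  shows "w \<in> region (<) \<or> w \<in> chain"
proof -
  obtain k s t where k: "k \<le> N" "s \<ge> 0" "t \<ge> 0" "w = s *\<^sub>R p k + t *\<^sub>R p (Suc k)" "s + t \<le> 1"
    using region_cone[OF _ assms(1)] by auto
  show ?thesis
  proof (cases "s + t < 1")
    case True
    then show ?thesis using k cone_region_iff[of "(<)" k s t] by simp
  next
    case False
    then have "s = 1 - t" using k by simp
    then have "w \<in> closed_segment (p k) (p (Suc k))"
      using k unfolding in_segment by (intro exI[of _ t]) auto
    then show ?thesis using k by (auto simp: chain_def)
  qed
qed

lemma compact_region: "compact (region (\<le>))"
proof -
  have "region (\<le>) = (\<Union>k\<in>{..N}. convex hull {0, p k, p (Suc k)})" (is "_ = ?T")
  proof
    show "region (\<le>) \<subseteq> ?T"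
    proof
      fix w assume "w \<in> region (\<le>)"
      then obtain k s t where k: "k \<le> N" "s \<ge> 0" "t \<ge> 0" "w = s *\<^sub>R p k + t *\<^sub>R p (Suc k)" "s + t \<le> 1"
        using region_cone[of "(\<le>)" w] by auto
      have "w = (1 - s - t) *\<^sub>R 0 + s *\<^sub>R p k + t *\<^sub>R p (Suc k)" using k by simp
      moreover have "1 - s - t \<ge> 0" "(1 - s - t) + s + t = 1" using k by auto
      ultimately have "w \<in> convex hull {0, p k, p (Suc k)}"
        unfolding convex_hull_3 using k by blast
      then show "w \<in> ?T" using k by auto
    qed
    show "?T \<subseteq> region (\<le>)"
    proof
      fix w assume "w \<in> ?T"
      then obtain k u s t where "k \<le> N" "s \<ge> 0" "t \<ge> 0" "u \<ge> 0" "u + s + t = 1"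
          "w = u *\<^sub>R 0 + s *\<^sub>R p k + t *\<^sub>R p (Suc k)"
        unfolding convex_hull_3 by auto
      then show "w \<in> region (\<le>)" using cone_region_iff[of "(\<le>)" k s t] by simp
    qed
  qed
  moreover have "compact ?T"
    by (intro compact_UN compact_convex_hull finite_imp_compact) auto
  ultimately show ?thesis by metis
qed

lemma continuous_on_edge: "continuous_on UNIV (edge i)"
  unfolding edge_def orient_def by (intro continuous_intros)

text \<open>The conditions are implications with closed premises, so the complement is a finite
  union of closed sets.\<close>

lemma open_region: "open (region (<))"
proof -
  have c2: "continuous_on UNIV (\<lambda>w::real^2. w$2)" by (intro continuous_intros)
  have cN: "continuous_on UNIV (\<lambda>w. orient w (p N) 0)"
    unfolding orient_0 by (intro continuous_intros)
  have cz: "continuous_on UNIV (\<lambda>w::real^2. 0::real)" by simp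
  note ce = continuous_on_edge
  have eq: "- region (<) =
     (\<Union>i\<in>{..m}. {w. 0 \<le> w$2} \<inter> {w. 0 \<le> edge i w})
     \<union> (\<Union>i\<in>{m<..<N}. {w. w$2 \<le> 0} \<inter> {w. orient w (p N) 0 \<le> 0} \<inter> {w. 0 \<le> edge i w})
     \<union> ({w. w$2 \<le> 0} \<inter> {w. 0 \<le> orient w (p N) 0} \<inter> {w. 0 \<le> edge N w})"
    unfolding region_def by (auto simp: not_less)
  have "closed (- region (<))"
    unfolding eq
    by (intro closed_Un closed_UN ballI closed_Int closed_Collect_le[OF cz c2]
        closed_Collect_le[OF c2 cz] closed_Collect_le[OF cz cN] closed_Collect_le[OF cN cz]
        closed_Collect_le[OF cz ce] finite_atMost finite_greaterThanLessThan)
  then show ?thesis by (simp add: closed_def)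
qed

lemma region_subset: "region (<) \<subseteq> region (\<le>)"
  by (auto simp: region_def less_imp_le)

lemma region_interior: "region (<) \<subseteq> interior (region (\<le>))"
  using open_region region_subset by (rule interior_maximal[rotated])

lemma region_closure: "region (\<le>) \<subseteq> closure (region (<))"
proof
  fix w assume w: "w \<in> region (\<le>)"
  have "(\<lambda>n. (1 - inverse (real (Suc n))) *\<^sub>R w) \<longlonglongrightarrow> (1 - 0) *\<^sub>R w"
    by (intro tendsto_intros LIMSEQ_inverse_real_of_nat)
  moreover have "(1 - inverse (real (Suc n))) *\<^sub>R w \<in> region (<)" for n
    using region_scaled(2)[OF w, of "1 - inverse (real (Suc n))"] by (simp add: field_simps)
  ultimately show "w \<in> closure (region (<))"
    unfolding closure_sequential
    by (intro exI[of _ "\<lambda>n. (1 - inverse (real (Suc n))) *\<^sub>R w"]) simp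
qed

lemma region_nonempty: "0 \<in> region (\<le>)"
  using region_upper_iff[of "(\<le>)" 0] origin m by (auto simp: edge_def less_imp_le)

text \<open>A component of the complement of the chain that meets the polygon cannot leave it,
  because the frontier lies in the chain; so it is bounded. From a point outside, the ray away from
  the origin avoids the polygon by star-shapedness, so its component is unbounded.\<close>

lemma chain_Un_inside: "chain \<union> inside chain = region (\<le>)"
proof (intro equalityI subsetI)
  fix w assume w: "w \<in> region (\<le>)"
  show "w \<in> chain \<union> inside chain"
  proof (cases "w \<in> chain")
    case False
    let ?C = "connected_component_set (- chain) w"
    have "?C \<subseteq> region (\<le>)"
    proof (rule ccontr)
      assume "\<not> ?thesis"
      moreover have "w \<in> ?C" using False by simp
      ultimately have "?C \<inter> frontier (region (\<le>)) \<noteq> {}"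
        using w connected_Int_frontier[OF connected_connected_component] by blast
      moreover have "frontier (region (\<le>)) \<subseteq> chain"
        using region_cases region_interior compact_imp_closed[OF compact_region]
        by (auto simp: frontier_def closure_closed)
      ultimately show False using connected_component_subset[of "- chain" w] by blast
    qed
    then have "bounded ?C"
      using bounded_subset compact_imp_bounded[OF compact_region] by blast
    then show ?thesis using False by (simp add: inside_def)
  qed simp
next
  fix w assume w: "w \<in> chain \<union> inside chain"
  show "w \<in> region (\<le>)"
  proof (rule ccontr)
    assume n: "w \<notin> region (\<le>)"
    then have w0: "w \<noteq> 0" using region_nonempty by auto
    let ?r = "(\<lambda>c. c *\<^sub>R w) ` {1..}"
    have "c *\<^sub>R w \<notin> region (\<le>)" if "c \<ge> 1" for c
      using region_scaled(1)[of "c *\<^sub>R w" "inverse c"] that n by (auto simp: field_simps)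
    then have "?r \<subseteq> - chain" using chain_subset_region by auto
    moreover have "connected ?r"
      by (intro connected_continuous_image continuous_intros) auto
    moreover have "w \<in> ?r" by (rule image_eqI[of _ _ 1]) auto
    ultimately have sub: "?r \<subseteq> connected_component_set (- chain) w"
      by (intro connected_component_maximal)
    have "w \<notin> chain" using n chain_subset_region by auto
    then have "bounded ?r" using w sub bounded_subset by (auto simp: inside_def)
    then obtain B where B: "\<And>c. c \<ge> 1 \<Longrightarrow> norm (c *\<^sub>R w) \<le> B" by (auto simp: bounded_iff)
    have "max 1 ((B + 1) / norm w) * norm w \<ge> (B + 1) / norm w * norm w"
      by (intro mult_right_mono) auto
    then have "norm (max 1 ((B + 1) / norm w) *\<^sub>R w) \<ge> B + 1"
      using w0 by simp
    then show False using B[of "max 1 ((B + 1) / norm w)"] by auto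
  qed
qed

end

section \<open>Trapping regions inside an invariant compact set\<close>

text \<open>By invariance of domain the image of the interior is open.\<close>

lemma image_interior_subset:
  fixes f :: "'a::euclidean_space \<Rightarrow> 'a"
  assumes "continuous_on UNIV f" "inj f" "f ` K \<subseteq> K"
  shows "f ` interior K \<subseteq> interior K"
proof (rule interior_maximal)
  show "f ` interior K \<subseteq> K" using assms(3) interior_subset by blast
  show "open (f ` interior K)"
    by (rule invariance_of_domain[OF continuous_on_subset[OF assms(1)] open_interior
          inj_on_subset[OF assms(2)]]) simp_all
qed

text \<open>With \<open>d\<close> the distance to the complement of \<open>interior K\<close>, the trapping region is
  \<open>{x. \<forall>i\<le>n. d ((f ^^ i) x) \<ge> \<eta> * (i + 1) / (n + 1)}\<close>: the bounds increase with \<open>i\<close>, so that they hold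
  strictly for \<open>f x\<close>.\<close>

lemma trapping_region_approximation:
  fixes f :: "'a::euclidean_space \<Rightarrow> 'a"
  assumes cont: "continuous_on UNIV f" and inj: "inj f"
    and K: "compact K" "K \<noteq> {}" and fK: "f ` K \<subseteq> K"
    and fn: "(f ^^ n) ` K \<subseteq> interior K"
    and cl: "K \<subseteq> closure (interior K)" and \<epsilon>: "\<epsilon> > 0"
  shows "\<exists>T. T \<subset> K \<and> trapping_region f T \<and> hausdorff_dist K T \<le> ereal \<epsilon>"
proof -
  define d where "d x = infdist x (- interior K)" for x
  have ne: "- interior K \<noteq> {}"
  proof
    assume "- interior K = {}"
    then have "K = UNIV" using interior_subset[of K] by blast
    then show False using compact_imp_bounded[OF K(1)] not_bounded_UNIV by blast
  qed
  have d0: "d x > 0 \<longleftrightarrow> x \<in> interior K" for x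
    using in_closed_iff_infdist_zero[of "- interior K" x] ne infdist_nonneg[of x "- interior K"]
    unfolding d_def by (auto simp: order_less_le)
  have contd: "continuous_on UNIV d"
    unfolding d_def by (intro continuous_intros)
  have contf: "continuous_on UNIV (f ^^ i)" for i
  proof (induction i)
    case (Suc i)
    then show ?case
      using continuous_on_compose[of UNIV "f ^^ i" f] continuous_on_subset[OF cont] by simp
  qed (simp add: id_def)
  have cdf: "continuous_on UNIV (\<lambda>x. d ((f ^^ i) x))" for i
    using continuous_on_compose[OF contf[of i], of d] continuous_on_subset[OF contd]
    by (simp add: o_def)
  have fint: "(f ^^ i) x \<in> interior K" if "x \<in> interior K" for i x
    using that image_interior_subset[OF cont inj fK] by (induction i) auto
  \<comment> \<open>A finite net of interior points; keeping it inside \<open>T\<close> bounds the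
    Hausdorff distance.\<close>
  obtain S where S: "finite S" "S \<subseteq> interior K" "K \<subseteq> (\<Union>y\<in>S. ball y \<epsilon>)"
  proof -
    have "K \<subseteq> (\<Union>y\<in>interior K. ball y \<epsilon>)"
    proof
      fix x assume "x \<in> K"
      then obtain y where "y \<in> interior K" "dist y x < \<epsilon>"
        using cl closure_approachable[of x "interior K"] \<epsilon> by blast
      then show "x \<in> (\<Union>y\<in>interior K. ball y \<epsilon>)" by auto
    qed
    then obtain S where "S \<subseteq> interior K" "finite S" "K \<subseteq> (\<Union>y\<in>S. ball y \<epsilon>)"
      using compactE_image[OF K(1), of "interior K" "\<lambda>y. ball y \<epsilon>"] by auto
    then show ?thesis using that by blast
  qed
  \<comment> \<open>The exponent is \<open>Suc n\<close> because the last bound, with index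
    \<open>n\<close>, is to be checked at \<open>f x\<close>, where no further bound for
    \<open>x\<close> is available.\<close>
  obtain c where c: "c > 0" "\<And>x. x \<in> K \<Longrightarrow> d ((f ^^ Suc n) x) \<ge> c"
  proof -
    obtain z where z: "z \<in> K" "\<And>x. x \<in> K \<Longrightarrow> d ((f ^^ Suc n) z) \<le> d ((f ^^ Suc n) x)"
      using continuous_attains_inf[OF K continuous_on_subset[OF cdf[of "Suc n"]]] by auto
    have "(f ^^ n) (f z) \<in> interior K" using fn fK z(1) by blast
    then have "d ((f ^^ Suc n) z) > 0" by (simp add: d0 funpow_swap1)
    then show ?thesis using that z(2) by blast
  qed
  \<comment> \<open>Collects what \<eta> must stay below: \<open>c\<close> for the last index, and
    the distances along the orbits of the net so that it lies in \<open>T\<close>. Halving the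
    minimum makes this strict.\<close>
  define D where "D = insert c ((\<lambda>(i, y). d ((f ^^ i) y)) ` ({..n} \<times> S))"
  define \<eta> where "\<eta> = Min D / 2"
  have D: "finite D" "D \<noteq> {}" using S(1) by (simp_all add: D_def)
  have "\<forall>a\<in>D. a > 0" using c(1) S(2) fint by (auto simp: D_def d0)
  then have MinD: "Min D > 0" using D by simp
  then have \<eta>: "\<eta> > 0" by (simp add: \<eta>_def)
  have lt: "\<eta> < a" if "a \<in> D" for a
    using Min_le[OF D(1) that] MinD by (simp add: \<eta>_def)
  define b where "b i = \<eta> * (real i + 1) / (real n + 1)" for i :: nat
  have b_mono: "b i < b (Suc i)" for i
    using \<eta> by (simp add: b_def divide_strict_right_mono)
  have b_pos: "b i > 0" for i using \<eta> by (simp add: b_def)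
  have b_le: "b i \<le> \<eta>" if "i \<le> n" for i
    using \<eta> that by (simp add: b_def pos_divide_le_eq mult_left_mono)
  define T where "T = {x. \<forall>i\<le>n. b i \<le> d ((f ^^ i) x)}"
  have T_int: "T \<subseteq> interior K"
  proof
    fix x assume "x \<in> T"
    then have "b 0 \<le> d x" by (auto simp: T_def)
    then show "x \<in> interior K" using b_pos[of 0] d0[of x] by linarith
  qed
  then have TK: "T \<subseteq> K" using interior_subset by blast
  have "T = (\<Inter>i\<in>{..n}. {x. b i \<le> d ((f ^^ i) x)})" by (auto simp: T_def)
  then have "closed T"
    by (auto intro!: closed_INT closed_Collect_le cdf continuous_intros)
  then have compT: "compact T"
    using K(1) TK compact_Int_closed[of K T] by (simp add: Int_absorb1)
  have "f ` T \<subseteq> interior T"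
  proof -
    let ?O = "\<Inter>i\<in>{..n}. {x. b i < d ((f ^^ i) x)}"
    have "open ?O" by (intro open_INT ballI open_Collect_less cdf continuous_intros) auto
    moreover have "?O \<subseteq> T" by (auto simp: T_def less_imp_le)
    moreover have "f x \<in> ?O" if x: "x \<in> T" for x
    proof -
      have "b i < d ((f ^^ i) (f x))" if i: "i \<le> n" for i
      proof (cases "i = n")
        case True
        have "b n \<le> \<eta>" using b_le by simp
        also have "\<eta> < c" using lt by (simp add: D_def)
        also have "c \<le> d ((f ^^ Suc n) x)" using c TK x by blast
        finally show ?thesis using True by (simp add: funpow_swap1)
      next
        case False
        then have "b (Suc i) \<le> d ((f ^^ Suc i) x)" using x i by (auto simp: T_def simp del: funpow.simps)
        then show ?thesis using b_mono[of i] by (simp add: funpow_swap1)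
      qed
      then show ?thesis by auto
    qed
    ultimately show ?thesis by (meson image_subsetI interior_maximal subsetD)
  qed
  then have trap: "trapping_region f T" using compT by (simp add: trapping_region_def)
  have ST: "S \<subseteq> T"
  proof
    fix y assume y: "y \<in> S"
    have "b i \<le> d ((f ^^ i) y)" if "i \<le> n" for i
    proof -
      have "d ((f ^^ i) y) \<in> D" unfolding D_def using that y by force
      then show ?thesis using b_le[OF that] lt by fastforce
    qed
    then show "y \<in> T" by (simp add: T_def)
  qed
  \<comment> \<open>Equality would make \<open>K\<close> open as well as compact and nonempty, hence
    the whole space.\<close>
  have "T \<noteq> K"
  proof
    assume "T = K"
    then have "K = interior K" using T_int interior_subset by blast
    then have "open K" using open_interior by metis
    then have "K = UNIV" using clopen[of K] K(2) compact_imp_closed[OF K(1)] by blast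
    then show False using compact_imp_bounded[OF K(1)] not_bounded_UNIV by blast
  qed
  moreover have "hausdorff_dist K T \<le> ereal \<epsilon>"
    unfolding hausdorff_dist_def
  proof (intro max.boundedI SUP_least)
    fix x assume "x \<in> K"
    then obtain y where y: "y \<in> S" "dist y x < \<epsilon>" using S(3) by auto
    have "(INF y\<in>T. ereal (dist x y)) \<le> ereal (dist x y)" using y ST by (intro INF_lower) auto
    also have "\<dots> \<le> ereal \<epsilon>" using y by (simp add: dist_commute)
    finally show "(INF y\<in>T. ereal (dist x y)) \<le> ereal \<epsilon>" .
  next
    fix y assume "y \<in> T"
    then have "(INF x\<in>K. ereal (dist x y)) \<le> ereal (dist y y)" using TK by (intro INF_lower) auto
    then show "(INF x\<in>K. ereal (dist x y)) \<le> ereal \<epsilon>"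
      using \<epsilon> by (simp add: order_trans)
  qed
  ultimately show ?thesis using TK trap by blast
qed

section \<open>The map on a fan polygon\<close>

text \<open>\<open>axis 1 1\<close> is the image of the origin, so a fan triangle goes to the
  triangle spanned by this point and the images of its other two vertices.\<close>

lemma affine_piece_lincomb:
  "affine_piece \<tau> \<delta> (s *\<^sub>R x + t *\<^sub>R y) =
     (1 - s - t) *\<^sub>R axis 1 1 + s *\<^sub>R affine_piece \<tau> \<delta> x + t *\<^sub>R affine_piece \<tau> \<delta> y"
  by (simp add: vec_eq_iff forall_2 axis_def algebra_simps)

lemma orient_affine_piece:
  "orient (affine_piece \<tau> \<delta> a) (affine_piece \<tau> \<delta> b) (affine_piece \<tau> \<delta> c) = \<delta> * orient a b c"
  by (simp add: orient_def algebra_simps)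

lemma bcnf_left: "x$1 \<le> 0 \<Longrightarrow> bcnf \<tau>L \<delta>L \<tau>R \<delta>R x = affine_piece \<tau>L \<delta>L x"
  by (simp add: bcnf_def)

lemma continuous_on_bcnf: "continuous_on UNIV (bcnf \<tau>L \<delta>L \<tau>R \<delta>R)"
proof -
  have c: "continuous_on S (affine_piece \<tau> \<delta>)" for \<tau> \<delta> S
    unfolding affine_piece_def by (intro continuous_intros)
  have "continuous_on ({x::real^2. x$1 \<le> 0} \<union> {x. 0 \<le> x$1})
      (\<lambda>x. if x$1 \<le> 0 then affine_piece \<tau>L \<delta>L x else affine_piece \<tau>R \<delta>R x)"
    by (rule continuous_on_If) 
      (auto intro!: closed_Collect_le continuous_intros c simp: vec_eq_iff forall_2)
  moreover have "{x::real^2. x$1 \<le> 0} \<union> {x. 0 \<le> x$1} = UNIV" by auto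
  ultimately show ?thesis by (simp add: bcnf_def[abs_def])
qed

text \<open>\<open>Y\<close> is the point where the last right-hand edge crosses the switching line; its image replaces
  \<open>p 0\<close> as the leftmost image of the right-hand part of the polygon.\<close>

locale fan_map = fan_polygon p m N for p m N +
  fixes \<tau>L \<delta>L \<tau>R \<delta>R \<sigma> y :: real and f :: "real^2 \<Rightarrow> real^2" and Y :: "real^2"
  assumes \<delta>: "\<delta>L > 0" "\<delta>R > 0"
    and f_def: "f = bcnf \<tau>L \<delta>L \<tau>R \<delta>R"
    and m1: "m \<ge> 1"
    and step: "\<And>k. 1 \<le> k \<Longrightarrow> k < N \<Longrightarrow> f (p k) = p (Suc k)"
    and \<sigma>: "0 \<le> \<sigma>" "\<sigma> \<le> 1" and f_left: "f (p 0) = (1 - \<sigma>) *\<^sub>R p 1 + \<sigma> *\<^sub>R p 2"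
    and left_points: "\<And>k. k \<le> m \<Longrightarrow> p k $ 1 \<le> 0"
    and right_points: "\<And>k. m \<le> k \<Longrightarrow> k < N \<Longrightarrow> p k $ 1 \<ge> 0" and last_right: "p (N - 1) $ 1 > 0"
    and right1: "p (Suc m) $ 1 > 1"
    and right_edges: "\<And>i j. m \<le> i \<Longrightarrow> Suc i < N \<Longrightarrow> orient (p i) (p (Suc i)) (p (N - 1)) \<le> 0"
    and right_edges': "\<And>i j. m \<le> i \<Longrightarrow> Suc i < N \<Longrightarrow> orient (p i) (p (Suc i)) (p N) < 0"
    and f_bottom: "\<And>i. i \<le> m \<Longrightarrow> orient (p i) (p (Suc i)) (f (p N)) < 0"
    and y: "0 < y" "y \<le> 1" and Y: "Y = (1 - y) *\<^sub>R p (N - 1) + y *\<^sub>R p N" "Y $ 1 = 0"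
    and fY_left: "Y $ 2 + 1 > p 0 $ 1"
begin

lemma f_L: "x $ 1 \<le> 0 \<Longrightarrow> f x = affine_piece \<tau>L \<delta>L x"
  by (simp add: f_def bcnf_left)

lemma f_R: "x $ 1 \<ge> 0 \<Longrightarrow> f x = affine_piece \<tau>R \<delta>R x"
  by (simp add: f_def bcnf_right)

lemma f_lincomb_left:
  assumes "a $ 1 \<le> 0" "b $ 1 \<le> 0" "s \<ge> 0" "t \<ge> 0"
  shows "f (s *\<^sub>R a + t *\<^sub>R b) = (1 - s - t) *\<^sub>R axis 1 1 + s *\<^sub>R f a + t *\<^sub>R f b"
proof -
  have "(s *\<^sub>R a + t *\<^sub>R b) $ 1 \<le> 0"
    using assms by (simp add: add_nonpos_nonpos mult_nonneg_nonpos)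
  then show ?thesis using assms by (simp only: f_L affine_piece_lincomb)
qed

lemma f_lincomb_right:
  assumes "a $ 1 \<ge> 0" "b $ 1 \<ge> 0" "s \<ge> 0" "t \<ge> 0"
  shows "f (s *\<^sub>R a + t *\<^sub>R b) = (1 - s - t) *\<^sub>R axis 1 1 + s *\<^sub>R f a + t *\<^sub>R f b"
proof -
  have "(s *\<^sub>R a + t *\<^sub>R b) $ 1 \<ge> 0" using assms by simp
  then show ?thesis using assms by (simp only: f_R affine_piece_lincomb)
qed

lemma axis_1_1_nth [simp]: "axis 1 1 $ 1 = (1::real)" "(axis 1 1 :: real^2) $ 2 = 0"
  by (simp_all add: axis_def)

text \<open>Meant for two points of the horizontal axis, which is the image of the switching line:
  the image of the apex and \<open>f Y\<close>.\<close>

lemma axis_region: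
  assumes "x $ 2 = 0" "p 0 $ 1 < x $ 1" "x $ 1 < p (Suc m) $ 1"
  shows "x \<in> region (<)"
proof (cases "x $ 1 \<ge> 0")
  case True
  with assms obtain c where c: "c \<ge> 0" "x = c *\<^sub>R p (Suc m)" by (auto elim: right_axis)
  then have "c < 1" using assms right by simp
  then show ?thesis
    using c right right_axis_iff(1)[of "(<)" c] region_upper_iff[of "(<)" x] by simp
next
  case False
  with assms obtain c where c: "c \<ge> 0" "x = c *\<^sub>R p 0" by (auto elim: left_axis)
  then have "c < 1" using assms left by (auto simp: mult_less_cancel_right)
  then show ?thesis
    using c left left_axis_iff(1)[of "(<)" c] region_upper_iff[of "(<)" x] by simp
qed

lemma axis_edge_upper:
  assumes "x $ 2 = 0" "p 0 $ 1 < x $ 1" "x $ 1 < p (Suc m) $ 1" "i \<le> m"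
  shows "edge i x < 0"
  using axis_region[OF assms(1-3)] region_upper_iff[of "(<)" x] assms by simp

lemma axis_edge_left:
  assumes "x $ 2 = 0" "p 0 $ 1 < x $ 1"
  shows "edge N x < 0"
proof -
  have "edge N x = p N $ 2 * (x $ 1 - p 0 $ 1)"
    using assms left by (simp add: edge_def orient_def algebra_simps)
  then show ?thesis using bottom assms by (simp add: mult_neg_pos)
qed

lemma f0_upper: "i \<le> m \<Longrightarrow> edge i (axis 1 1) < 0"
  using axis_edge_upper[of "axis 1 1"] left right1 by simp

lemma f0_lower: "m < i \<Longrightarrow> i < N \<Longrightarrow> edge i (axis 1 1) < 0"
  using axis_region[of "axis 1 1"] region_lower_iff[of "(<)" "axis 1 1"] left right1 bottom
  by (simp add: orient_0)

lemma fp0_edge: "i \<le> m \<Longrightarrow> edge i (f (p 0)) \<le> 0"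
  using upper_edges[of i 1] upper_edges[of i 2] m1 \<sigma>
  by (simp add: f_left edge_def orient_convex2 add_nonpos_nonpos mult_nonneg_nonpos)

lemma edge_convex3:
  "edge i ((1 - s - t) *\<^sub>R z + s *\<^sub>R a + t *\<^sub>R b) =
     (1 - s - t) * edge i z + s * edge i a + t * edge i b"
  by (simp add: edge_def orient_convex3)

lemma convex3_nonpos:
  fixes s t z a b :: real
  assumes "s \<ge> 0" "t \<ge> 0" "s + t \<le> 1" "z \<le> 0" "a \<le> 0" "b \<le> 0"
  shows "(1 - s - t) * z + s * a + t * b \<le> 0"
  using assms by (simp add: add_nonpos_nonpos mult_nonneg_nonpos)

text \<open>The last premise ensures that some strictly negative value receives positive
  weight.\<close>

lemma convex3_neg:
  fixes s t z a b :: real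
  assumes "s \<ge> 0" "t \<ge> 0" "s + t \<le> 1" "z < 0" "a \<le> 0" "b \<le> 0"
    and "s + t < 1 \<or> a < 0 \<and> b < 0 \<or> a < 0 \<and> t < 1 \<or> b < 0 \<and> s < 1"
  shows "(1 - s - t) * z + s * a + t * b < 0"
proof -
  have *: "(1 - s - t) * z \<le> 0" "s * a \<le> 0" "t * b \<le> 0"
    using assms by (simp_all add: mult_nonneg_nonpos)
  have "s + t < 1 \<Longrightarrow> (1 - s - t) * z < 0" "s > 0 \<Longrightarrow> a < 0 \<Longrightarrow> s * a < 0"
    "t > 0 \<Longrightarrow> b < 0 \<Longrightarrow> t * b < 0"
    using assms by (simp_all add: mult_pos_neg)
  moreover have "s + t < 1 \<or> (s > 0 \<and> a < 0) \<or> (t > 0 \<and> b < 0)"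
    using assms by linarith
  ultimately show ?thesis using * by linarith
qed

text \<open>The image lies in the upper half plane, so only the edges up to \<open>m\<close> are
  tested, and only at the images of the three vertices.\<close>

lemma f_upper_left:
  assumes k: "k < m" and st: "s \<ge> 0" "t \<ge> 0" "s + t \<le> 1"
  shows "f (s *\<^sub>R p k + t *\<^sub>R p (Suc k)) \<in> region (\<le>)"
proof -
  have eq: "f (s *\<^sub>R p k + t *\<^sub>R p (Suc k)) =
      (1 - s - t) *\<^sub>R axis 1 1 + s *\<^sub>R f (p k) + t *\<^sub>R f (p (Suc k))"
    using k st left_points by (intro f_lincomb_left) auto
  have *: "f (p j) $ 2 \<ge> 0" "i \<le> m \<Longrightarrow> edge i (f (p j)) \<le> 0" if "j \<le> m" for i j
  proof -
    show "f (p j) $ 2 \<ge> 0"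
      using that left_points[OF that] \<delta> by (simp add: f_L mult_nonneg_nonpos)
    show "edge i (f (p j)) \<le> 0" if "i \<le> m"
      using that \<open>j \<le> m\<close> fp0_edge step[of j] upper_edges[of i "Suc j"] m
      by (cases "j = 0") (auto simp: edge_def)
  qed
  have "edge i ((1 - s - t) *\<^sub>R axis 1 1 + s *\<^sub>R f (p k) + t *\<^sub>R f (p (Suc k))) \<le> 0"
    if "i \<le> m" for i
    unfolding edge_convex3 using k st * that f0_upper[OF that] by (intro convex3_nonpos) auto
  then show ?thesis
    unfolding eq using k st * by (subst region_upper_iff) auto
qed

lemma f_right:
  assumes k: "m \<le> k" "Suc k < N" and st: "s \<ge> 0" "t \<ge> 0" "s + t \<le> 1"
  shows "f (s *\<^sub>R p k + t *\<^sub>R p (Suc k)) \<in> region (\<le>)"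
proof -
  let ?w = "(1 - s - t) *\<^sub>R axis 1 1 + s *\<^sub>R p (Suc k) + t *\<^sub>R p (Suc (Suc k))"
  have eq: "f (s *\<^sub>R p k + t *\<^sub>R p (Suc k)) = ?w"
    using k st right_points m1 step by (subst f_lincomb_right) auto
  have pts: "p (Suc k) $ 2 \<le> 0" "p (Suc (Suc k)) $ 2 \<le> 0"
    "orient (p (Suc k)) (p N) 0 \<le> 0" "orient (p (Suc (Suc k))) (p N) 0 \<le> 0"
    using lower_points lower_points' k by auto
  have "?w $ 2 \<le> 0"
    using pts st by (simp add: add_nonpos_nonpos mult_nonneg_nonpos)
  moreover have "orient ?w (p N) 0 = (1 - s - t) * orient (axis 1 1) (p N) 0
      + s * orient (p (Suc k)) (p N) 0 + t * orient (p (Suc (Suc k))) (p N) 0"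
    by (simp add: orient_0 algebra_simps)
  then have "orient ?w (p N) 0 \<le> 0"
    using pts st bottom by (auto simp: orient_0 intro!: convex3_nonpos)
  moreover have "edge i ?w \<le> 0" if i: "m < i" "i < N" for i
    unfolding edge_convex3 using st i k f0_lower[OF i] lower_edges[OF i]
    by (intro convex3_nonpos) (auto simp: edge_def)
  ultimately show ?thesis
    unfolding eq by (subst region_lower_iff) auto
qed

lemma Y2: "Y $ 2 < 0"
proof -
  have "p (N - 1) $ 2 \<le> 0" using lower_points[of "N - 1"] m by simp
  then have "(1 - y) * p (N - 1) $ 2 \<le> 0" using y by (simp add: mult_nonneg_nonpos)
  moreover have "y * p N $ 2 < 0" using y bottom by (simp add: mult_pos_neg)
  ultimately show ?thesis by (simp add: Y(1))
qed

lemma fY: "f Y $ 1 = Y $ 2 + 1" "f Y $ 2 = 0"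
  using Y(2) by (simp_all add: f_L)

lemma fY_upper: "i \<le> m \<Longrightarrow> edge i (f Y) < 0"
  using axis_edge_upper[of "f Y"] fY fY_left Y2 right1 by simp

text \<open>Such an edge is the image of its predecessor under the right piece, so the test can be
  pulled back to \<open>Y\<close>, a combination of \<open>p (N - 1)\<close> and \<open>p N\<close>
  with positive weight on the latter.\<close>

lemma fY_lower:
  assumes "m < i" "i < N"
  shows "edge i (f Y) < 0"
proof -
  obtain k where k: "i = Suc k" "m \<le> k" "Suc k < N" using assms by (cases i) auto
  have "edge i (f Y) = orient (f (p k)) (f (p (Suc k))) (f Y)"
    using k m1 step by (simp add: edge_def)
  also have "\<dots> = \<delta>R * orient (p k) (p (Suc k)) Y"
    using k right_points Y(2) by (simp add: f_R orient_affine_piece)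
  also have "orient (p k) (p (Suc k)) Y < 0"
  proof -
    have "(1 - y) * orient (p k) (p (Suc k)) (p (N - 1)) \<le> 0"
      using right_edges[OF k(2,3)] y by (simp add: mult_nonneg_nonpos)
    moreover have "y * orient (p k) (p (Suc k)) (p N) < 0"
      using right_edges'[OF k(2,3)] y by (simp add: mult_pos_neg)
    ultimately show ?thesis unfolding Y(1) orient_convex2 by linarith
  qed
  then have "\<delta>R * orient (p k) (p (Suc k)) Y < 0" using \<delta> by (simp add: mult_pos_neg)
  finally show ?thesis .
qed

text \<open>The bound \<open>s < 1\<close> excludes exactly \<open>p (N - 1)\<close>, whose image is
  the vertex \<open>p N\<close>. The image triangle may lie on both sides of the ray through
  \<open>p N\<close>, so both lower sectors are tested.\<close>

lemma f_crossing_right: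
  assumes st: "s \<ge> 0" "t \<ge> 0" "s + t \<le> 1" and s: "s < 1"
  shows "f (s *\<^sub>R p (N - 1) + t *\<^sub>R Y) \<in> region (<)"
proof -
  let ?w = "(1 - s - t) *\<^sub>R axis 1 1 + s *\<^sub>R p N + t *\<^sub>R f Y"
  have "N - 1 < N" "1 \<le> N - 1" using m by auto
  then have eq: "f (s *\<^sub>R p (N - 1) + t *\<^sub>R Y) = ?w"
    using st last_right Y(2) step[of "N - 1"] by (subst f_lincomb_right) auto
  have w2: "?w $ 2 \<le> 0"
    using bottom fY st by (simp add: mult_nonneg_nonpos)
  have lower: "edge i ?w < 0" if i: "m < i" "i < N" for i
    unfolding edge_convex3 using st s f0_lower[OF i] lower_edges[OF i, of N] fY_lower[OF i] m
    by (intro convex3_neg) (auto simp: edge_def)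
  have left: "edge N ?w < 0"
    unfolding edge_convex3
    using st s axis_edge_left[of "axis 1 1"] axis_edge_left[of "f Y"] fY fY_left left
    by (intro convex3_neg) auto
  show ?thesis
    unfolding eq
  proof (cases "orient ?w (p N) 0 \<le> 0")
    case True
    then show "?w \<in> region (<)" using region_lower_iff[OF _ w2] lower by simp
  next
    case False
    then show "?w \<in> region (<)" using region_left_iff[OF _ w2] left by simp
  qed
qed

lemma f_crossing_left:
  assumes st: "s \<ge> 0" "t \<ge> 0" "s + t \<le> 1"
  shows "f (s *\<^sub>R Y + t *\<^sub>R p N) \<in> region (<)"
proof -
  let ?w = "(1 - s - t) *\<^sub>R axis 1 1 + s *\<^sub>R f Y + t *\<^sub>R f (p N)"
  have eq: "f (s *\<^sub>R Y + t *\<^sub>R p N) = ?w"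
    using st bottom Y(2) by (subst f_lincomb_left) auto
  have w2: "?w $ 2 \<ge> 0"
    using bottom fY st \<delta> by (simp add: f_L mult_nonneg_nonpos)
  moreover have "edge i ?w < 0" if i: "i \<le> m" for i
    unfolding edge_convex3 using st f0_upper[OF i] fY_upper[OF i] f_bottom[OF i]
    by (intro convex3_neg) (auto simp: edge_def)
  ultimately show ?thesis unfolding eq by (subst region_upper_iff) auto
qed

lemma f_crossing:
  assumes st: "s \<ge> 0" "t \<ge> 0" "s + t \<le> 1" and s: "s < 1"
  shows "f (s *\<^sub>R p (N - 1) + t *\<^sub>R p N) \<in> region (<)"
proof -
  have A: "p (N - 1) $ 1 > 0" by (rule last_right)
  have Y1: "(1 - y) * p (N - 1) $ 1 + y * p N $ 1 = 0" using Y by simp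
  show ?thesis
  proof (cases "(s *\<^sub>R p (N - 1) + t *\<^sub>R p N) $ 1 \<ge> 0")
    case True
    \<comment> \<open>Substitutes for \<open>p N\<close> by solving the equation of \<open>Y\<close>
      for it; the sum of the two weights is unchanged.\<close>
    define s' where "s' = s - t * (1 - y) / y"
    have eq: "s *\<^sub>R p (N - 1) + t *\<^sub>R p N = s' *\<^sub>R p (N - 1) + (t / y) *\<^sub>R Y"
      using y by (simp add: s'_def Y(1) vec_eq_iff field_simps)
    have "s' * p (N - 1) $ 1 \<ge> 0" using True unfolding eq by (simp add: Y(2))
    then have "s' \<ge> 0" using A by (simp add: zero_le_mult_iff)
    moreover have "t / y \<ge> 0" using st y by simp
    moreover have "s' + t / y = s + t" using y by (simp add: s'_def field_simps)
    moreover have "s' < 1"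
    proof -
      have "t * (1 - y) / y \<ge> 0" using st y by simp
      then show ?thesis using s by (simp add: s'_def)
    qed
    ultimately show ?thesis
      unfolding eq using st by (intro f_crossing_right) auto
  next
    case False
    then have neg: "s * p (N - 1) $ 1 + t * p N $ 1 \<le> 0" by simp
    show ?thesis
    proof (cases "y = 1")
      \<comment> \<open>Here \<open>Y\<close> coincides with \<open>p N\<close>, so the piece to the
        left of the switching line degenerates to a segment.\<close>
      case True
      then have "s * p (N - 1) $ 1 \<le> 0" using neg Y1 by simp
      then have "s = 0" using A st by (simp add: mult_le_0_iff)
      then show ?thesis using f_crossing_left[of 0 t] st by simp
    next
      case F: False
      then have y1: "1 - y > 0" using y by simp
      \<comment> \<open>Now \<open>p (N - 1)\<close> is eliminated in favour of \<open>Y\<close>,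
        again keeping the total weight.\<close>
      obtain a where a: "s = a * (1 - y)" using y1 by (metis nonzero_eq_divide_eq less_irrefl)
      define t' where "t' = t - a * y"
      have eq: "s *\<^sub>R p (N - 1) + t *\<^sub>R p N = a *\<^sub>R Y + t' *\<^sub>R p N"
        unfolding a t'_def Y(1) by (simp add: vec_eq_iff algebra_simps)
      have "y * p N $ 1 < 0" using Y1 mult_pos_pos[OF y1 A] by linarith
      then have Z: "p N $ 1 < 0" using y by (simp add: mult_less_0_iff)
      have "(s *\<^sub>R p (N - 1) + t *\<^sub>R p N) $ 1 < 0" using False by simp
      then have "t' * p N $ 1 < 0" unfolding eq by (simp add: Y(2))
      then have "t' \<ge> 0" using Z by (simp add: mult_less_0_iff)
      moreover have "a \<ge> 0" using st(1) y1 unfolding a by (simp add: zero_le_mult_iff)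
      moreover have "a + t' = s + t" by (simp add: a t'_def algebra_simps)
      ultimately show ?thesis
        unfolding eq using st by (intro f_crossing_left) auto
    qed
  qed
qed

text \<open>The bound \<open>t < 1\<close> excludes only \<open>p 0\<close>, whose image lies on the
  edge from \<open>p 1\<close> to \<open>p 2\<close>.\<close>

lemma f_lower_left:
  assumes st: "s \<ge> 0" "t \<ge> 0" "s + t \<le> 1"
  shows "f (s *\<^sub>R p N + t *\<^sub>R p 0) \<in> region (\<le>)"
    and "t < 1 \<Longrightarrow> f (s *\<^sub>R p N + t *\<^sub>R p 0) \<in> region (<)"
proof -
  let ?w = "(1 - s - t) *\<^sub>R axis 1 1 + s *\<^sub>R f (p N) + t *\<^sub>R f (p 0)"
  have eq: "f (s *\<^sub>R p N + t *\<^sub>R p 0) = ?w"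
    using st bottom left by (subst f_lincomb_left) auto
  have "f (p N) $ 2 \<ge> 0" "f (p 0) $ 2 \<ge> 0"
    using bottom left \<delta> by (simp_all add: f_L mult_nonneg_nonpos)
  then have w2: "?w $ 2 \<ge> 0" using st by simp
  have "edge i ?w \<le> 0" if i: "i \<le> m" for i
    unfolding edge_convex3 using st f0_upper[OF i] fp0_edge[OF i] f_bottom[OF i]
    by (intro convex3_nonpos) (auto simp: edge_def)
  then show "f (s *\<^sub>R p N + t *\<^sub>R p 0) \<in> region (\<le>)"
    unfolding eq using w2 by (subst region_upper_iff) auto
  have "edge i ?w < 0" if i: "i \<le> m" and "t < 1" for i
    unfolding edge_convex3 using st that(2) f0_upper[OF i] fp0_edge[OF i] f_bottom[OF i]
    by (intro convex3_neg) (auto simp: edge_def)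
  then show "f (s *\<^sub>R p N + t *\<^sub>R p 0) \<in> region (<)" if "t < 1"
    unfolding eq using w2 that by (subst region_upper_iff) auto
qed

lemma region_invariant: "f ` region (\<le>) \<subseteq> region (\<le>)"
proof (rule image_subsetI)
  fix w assume "w \<in> region (\<le>)"
  then obtain k s t where k: "k \<le> N" "w = s *\<^sub>R p k + t *\<^sub>R p (Suc k)"
    and st: "s \<ge> 0" "t \<ge> 0" "s + t \<le> 1"
    using region_cone[of "(\<le>)" w] order_rel_simps(1) by metis
  have "N - 1 < N" "1 \<le> N - 1" "Suc (N - 1) = N" using m by auto
  consider "k < m" | "m \<le> k" "Suc k < N" | "k = N - 1" "s < 1" | "k = N - 1" "s = 1" "t = 0" | "k = N"
    using k st by linarith
  then show "f w \<in> region (\<le>)"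
  proof cases
    case 1
    then show ?thesis using k st f_upper_left by simp
  next
    case 2
    then show ?thesis using k st f_right by simp
  next
    case 3
    then show ?thesis using k st f_crossing region_subset \<open>Suc (N - 1) = N\<close> by auto
  next
    case 4
    then have "f w = p N" using k step[of "N - 1"] \<open>Suc (N - 1) = N\<close> \<open>1 \<le> N - 1\<close> by simp
    then show ?thesis using cone_region_iff[of "(\<le>)" N 1 0] by simp
  next
    case 5
    then show ?thesis using k st f_lower_left left by simp
  qed
qed

lemma inj_f: "inj f"
  using bij_bcnf[OF \<delta>] by (simp add: f_def bij_def)

lemma interior_invariant: "f ` interior (region (\<le>)) \<subseteq> interior (region (\<le>))"
  by (rule image_interior_subset[OF _ inj_f region_invariant]) (simp add: f_def continuous_on_bcnf)

lemma interior_iterate: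
  "x \<in> interior (region (\<le>)) \<Longrightarrow> (f ^^ i) x \<in> interior (region (\<le>))"
  using interior_invariant by (induction i) auto

lemma f_segment:
  assumes "a $ 1 \<le> 0 \<and> b $ 1 \<le> 0 \<or> a $ 1 \<ge> 0 \<and> b $ 1 \<ge> 0" "x \<in> closed_segment a b"
  shows "f x \<in> closed_segment (f a) (f b)"
proof -
  obtain u where u: "0 \<le> u" "u \<le> 1" "x = (1 - u) *\<^sub>R a + u *\<^sub>R b"
    using assms(2) by (auto simp: in_segment)
  then have "f x = (1 - u) *\<^sub>R f a + u *\<^sub>R f b"
    using assms(1) f_lincomb_left[of a b "1 - u" u] f_lincomb_right[of a b "1 - u" u] by auto
  then show ?thesis using u by (auto simp: in_segment)
qed

lemma iterate_into_interior:
  assumes "(f ^^ i) x \<in> interior (region (\<le>))" "i \<le> j"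
  shows "(f ^^ j) x \<in> interior (region (\<le>))"
  using interior_iterate[OF assms(1), of "j - i"] assms(2) by (metis funpow_add le_add_diff_inverse2 o_apply)

lemma f_pN_interior: "f (p N) \<in> interior (region (\<le>))"
  using f_lower_left(2)[of 1 0] region_interior by auto

text \<open>Each edge is carried to the next until the last one. There every point but the initial
  vertex enters at once; that vertex passes through \<open>p N\<close> and needs one more step,
  whence the exponent.\<close>

lemma segment_into_interior:
  assumes "1 \<le> k" "k < N" "x \<in> closed_segment (p k) (p (Suc k))"
  shows "(f ^^ (Suc N - k)) x \<in> interior (region (\<le>))"
  using assms
proof (induction "N - k" arbitrary: k x)
  case (Suc n)
  obtain u where u: "0 \<le> u" "u \<le> 1" "x = (1 - u) *\<^sub>R p k + u *\<^sub>R p (Suc k)"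
    using Suc.prems by (auto simp: in_segment)
  have s: "Suc N - k = Suc (N - k)" using Suc.prems by auto
  show ?case
  proof (cases "Suc k < N")
    case True
    \<comment> \<open>No edge before the last crosses the switching line, because \<open>p m\<close>
      lies on it.\<close>
    have "p k $ 1 \<le> 0 \<and> p (Suc k) $ 1 \<le> 0 \<or> p k $ 1 \<ge> 0 \<and> p (Suc k) $ 1 \<ge> 0"
      using left_points[of k] left_points[of "Suc k"] right_points[of k] right_points[of "Suc k"] True
      by linarith
    then have "f x \<in> closed_segment (f (p k)) (f (p (Suc k)))"
      using Suc.prems(3) by (rule f_segment)
    then have "f x \<in> closed_segment (p (Suc k)) (p (Suc (Suc k)))"
      using step[of k] step[of "Suc k"] Suc.prems True by simp
    then have "(f ^^ (Suc N - Suc k)) (f x) \<in> interior (region (\<le>))"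
      using Suc.hyps True by (intro Suc.hyps(1)) auto
    then show ?thesis using s by (simp add: funpow_swap1)
  next
    case False
    then have k: "k = N - 1" "Suc (N - 1) = N" using Suc.prems by auto
    have two: "Suc N - k = 2" using k by simp
    have "f (f x) \<in> interior (region (\<le>))"
    proof (cases "u = 0")
      case True
      then show ?thesis using u Suc.prems step[of k] k f_pN_interior by simp
    next
      case False
      then have "f x \<in> region (<)" using f_crossing[of "1 - u" u] u k by simp
      then show ?thesis using region_interior interior_invariant by blast
    qed
    then show ?thesis unfolding two by (simp add: numeral_2_eq_2)
  qed
qed simp

lemma fp0_segment: "f (p 0) \<in> closed_segment (p 1) (p 2)"
  unfolding f_left using \<sigma> by (auto simp: in_segment)

lemma segment1_into_interior:
  assumes "f x \<in> closed_segment (p 1) (p 2)"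
  shows "(f ^^ Suc N) x \<in> interior (region (\<le>))"
  using segment_into_interior[of 1 "f x"] assms m1 m by (simp add: funpow_swap1 numeral_2_eq_2)

text \<open>The slowest points are those of edge 0: one step takes them to edge 1, from which up to
  \<open>N\<close> more are needed.\<close>

lemma eventually_interior: "(f ^^ Suc N) ` region (\<le>) \<subseteq> interior (region (\<le>))"
proof (rule image_subsetI)
  fix w assume w: "w \<in> region (\<le>)"
  show "(f ^^ Suc N) w \<in> interior (region (\<le>))"
  proof (cases "w \<in> chain")
    case False
    then show ?thesis using region_cases[OF w] region_interior interior_iterate by blast
  next
    case True
    then obtain k where k: "k \<le> N" "w \<in> closed_segment (p k) (p (Suc k))" by (auto simp: chain_def)
    consider "k = 0" | "1 \<le> k" "k < N" | "k = N" using k by linarith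
    then show ?thesis
    proof cases
      case 1
      then have "f w \<in> closed_segment (f (p 0)) (p 2)"
        using f_segment[of "p 0" "p 1" w] left_points[of 0] left_points[of 1] k m1 m step[of 1]
        by (simp add: numeral_2_eq_2)
      moreover have "closed_segment (f (p 0)) (p 2) \<subseteq> closed_segment (p 1) (p 2)"
        using fp0_segment by (simp add: subset_closed_segment)
      ultimately show ?thesis using segment1_into_interior by blast
    next
      case 2
      then show ?thesis
        using iterate_into_interior[OF segment_into_interior] k by (metis diff_le_self)
    next
      case 3
      then obtain u where u: "0 \<le> u" "u \<le> 1" "w = (1 - u) *\<^sub>R p N + u *\<^sub>R p 0"
        using k left by (auto simp: in_segment)
      show ?thesis
      proof (cases "u = 1")
        case True
        then show ?thesis using u fp0_segment by (intro segment1_into_interior) simp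
      next
        case False
        then have "(f ^^ 1) w \<in> interior (region (\<le>))"
          using f_lower_left(2)[of "1 - u" u] u region_interior by auto
        then show ?thesis by (rule iterate_into_interior) simp
      qed
    qed
  qed
qed

end

lemma (in fan_map) forward_invariant_and_trapping:
  "f ` (chain \<union> inside chain) \<subseteq> chain \<union> inside chain \<and>
    (\<forall>\<epsilon>>0. \<exists>T. T \<subset> chain \<union> inside chain \<and> trapping_region f T \<and>
       hausdorff_dist (chain \<union> inside chain) T \<le> ereal \<epsilon>)"
  unfolding chain_Un_inside
proof (intro conjI allI impI region_invariant)
  fix \<epsilon> :: real assume "\<epsilon> > 0"
  moreover have "region (\<le>) \<subseteq> closure (interior (region (\<le>)))"
    using region_closure closure_mono[OF region_interior] by blast
  ultimately show "\<exists>T. T \<subset> region (\<le>) \<and> trapping_region f T \<and>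
      hausdorff_dist (region (\<le>)) T \<le> ereal \<epsilon>"
    using trapping_region_approximation[OF _ inj_f compact_region _ region_invariant
        eventually_interior] region_nonempty
    by (auto simp: f_def continuous_on_bcnf)
qed

section \<open>The polygon of the orbit\<close>

lemma closed_chain_conv:
  assumes "length ps = Suc N" "\<And>k. k \<le> N \<Longrightarrow> ps ! k = p k" "p (Suc N) = p 0"
  shows "closed_chain ps = (\<Union>k\<le>N. closed_segment (p k) (p (Suc k)))"
proof -
  have "closed_segment (ps ! k) (ps ! (Suc k mod Suc N)) = closed_segment (p k) (p (Suc k))"
    if "k \<le> N" for k
  proof (cases "k = N")
    case False
    then have "Suc k mod Suc N = Suc k" using that by simp
    then show ?thesis using that False assms by simp
  qed (use assms in simp)
  then show ?thesis
    unfolding closed_chain_def assms(1) lessThan_Suc_atMost by (metis (no_types, lifting) SUP_cong atMost_iff)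
qed

locale returning_orbit =
  fixes \<tau>L \<tau>R \<delta>L \<delta>R \<beta> :: real and f :: "real^2 \<Rightarrow> real^2" and X :: "real^2"
  assumes \<delta>: "\<delta>L > 0" "\<delta>R > 0"
    and f_def: "f = bcnf \<tau>L \<delta>L \<tau>R \<delta>R"
    and \<beta>: "\<beta> > 0" and X_def: "X = vector [0, \<beta>]"
    and fwd: "\<exists>i\<ge>1. (f ^^ i) X $ 1 \<le> 0"
    and bwd: "\<exists>j\<ge>1. (inv f ^^ j) X $ 1 \<ge> 0"
begin

abbreviation "r \<equiv> fwd_time f X"
abbreviation "\<l> \<equiv> bwd_time f X"
abbreviation "V \<equiv> V_pt f X"
abbreviation "Z \<equiv> Z_pt f X"
abbreviation "U \<equiv> U_pt f X"
abbreviation "Y \<equiv> Y_pt f X"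

text \<open>Numbering the orbit from \<open>V\<close> puts \<open>X\<close> at index
  \<open>m\<close>, \<open>f X\<close> at \<open>Suc m\<close> and \<open>Z\<close> at
  \<open>N\<close>.\<close>

definition "m = \<l> - 1"
definition "N = m + r"
definition "q i = (f ^^ i) V"

lemma f_L: "x $ 1 \<le> 0 \<Longrightarrow> f x = affine_piece \<tau>L \<delta>L x"
  by (simp add: f_def bcnf_left)

lemma f_R: "x $ 1 \<ge> 0 \<Longrightarrow> f x = affine_piece \<tau>R \<delta>R x"
  by (simp add: f_def bcnf_right)

lemma bij_f: "bij f"
  unfolding f_def by (rule bij_bcnf[OF \<delta>])

lemma f_inv [simp]: "f (inv f x) = x"
  using bij_f by (simp add: bij_def surj_f_inv_f)

lemma inv_f [simp]: "inv f (f x) = x"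
  using bij_f by (simp add: bij_def)

lemma f_sign: "f x $ 2 > 0 \<longleftrightarrow> x $ 1 < 0" "f x $ 2 < 0 \<longleftrightarrow> x $ 1 > 0" "f x $ 2 = 0 \<longleftrightarrow> x $ 1 = 0"
  using \<delta> by (auto simp: f_def bcnf_def mult_less_0_iff zero_less_mult_iff)

lemma X: "X $ 1 = 0" "X $ 2 = \<beta>"
  by (simp_all add: X_def vector_2)

lemma fX: "f X $ 1 = \<beta> + 1" "f X $ 2 = 0"
  by (simp_all add: f_L X)

lemma fwd_time: "r \<ge> 2" "(f ^^ r) X $ 1 \<le> 0" "\<And>i. 1 \<le> i \<Longrightarrow> i < r \<Longrightarrow> (f ^^ i) X $ 1 > 0"
proof -
  have r: "r \<ge> 1 \<and> (f ^^ r) X $ 1 \<le> 0"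
    unfolding fwd_time_def by (rule LeastI_ex) (use fwd in auto)
  show "(f ^^ r) X $ 1 \<le> 0" using r by simp
  show "(f ^^ i) X $ 1 > 0" if "1 \<le> i" "i < r" for i
    using not_less_Least[of i "\<lambda>i. i \<ge> 1 \<and> (f ^^ i) X $ 1 \<le> 0"] that
    unfolding fwd_time_def by auto
  have "r \<noteq> 1" using r fX \<beta> by auto
  then show "r \<ge> 2" using r by simp
qed

lemma bwd_time: "\<l> \<ge> 2" "(inv f ^^ \<l>) X $ 1 \<ge> 0"
  "\<And>i. 1 \<le> i \<Longrightarrow> i < \<l> \<Longrightarrow> (inv f ^^ i) X $ 1 < 0"
proof -
  have l: "\<l> \<ge> 1 \<and> (inv f ^^ \<l>) X $ 1 \<ge> 0"
    unfolding bwd_time_def by (rule LeastI_ex) (use bwd in auto)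
  show "(inv f ^^ \<l>) X $ 1 \<ge> 0" using l by simp
  show "(inv f ^^ i) X $ 1 < 0" if "1 \<le> i" "i < \<l>" for i
    using not_less_Least[of i "\<lambda>j. j \<ge> 1 \<and> (inv f ^^ j) X $ 1 \<ge> 0"] that
    unfolding bwd_time_def by auto
  have "inv f X $ 1 < 0" using f_sign(1)[of "inv f X"] X \<beta> by simp
  then have "\<l> \<noteq> 1" using l by auto
  then show "\<l> \<ge> 2" using l by simp
qed

lemma m: "m \<ge> 1" "\<l> = Suc m" and N: "N \<ge> Suc (Suc m)"
  using bwd_time(1) fwd_time(1) by (auto simp: m_def N_def)

lemma iterate_inv [simp]: "(f ^^ j) ((inv f ^^ j) x) = x"
  by (induction j arbitrary: x) (simp_all add: funpow_swap1)

lemma q_Suc: "q (Suc i) = f (q i)"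
  by (simp add: q_def)

lemma q_0: "q 0 = V" by (simp add: q_def)

lemma q_left: "i \<le> m \<Longrightarrow> q i = (inv f ^^ (m - i)) X"
proof -
  assume "i \<le> m"
  then have "(inv f ^^ m) X = (inv f ^^ i) ((inv f ^^ (m - i)) X)"
    by (metis funpow_add le_add_diff_inverse o_apply)
  then show ?thesis by (simp add: q_def V_pt_def m(2))
qed

lemma q_m: "q m = X" by (simp add: q_left)

lemma q_right: "q (m + i) = (f ^^ i) X"
  by (induction i) (simp_all add: q_m q_Suc)

lemma q_N: "q N = Z" by (simp add: N_def q_right Z_pt_def)

lemma q_Sm: "q (Suc m) $ 1 = \<beta> + 1" "q (Suc m) $ 2 = 0"
  by (simp_all add: q_Suc q_m fX)

lemma q_neg: "i < m \<Longrightarrow> q i $ 1 < 0"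
  using bwd_time(3)[of "m - i"] m by (simp add: q_left)

lemma q_nonpos: "i \<le> m \<Longrightarrow> q i $ 1 \<le> 0"
  using q_neg[of i] q_m X by (cases "i = m") auto

lemma q_pos: "m < i \<Longrightarrow> i < N \<Longrightarrow> q i $ 1 > 0"
  using fwd_time(3)[of "i - m"] q_right[of "i - m"] by (simp add: N_def)

lemma q_nonneg: "m \<le> i \<Longrightarrow> i < N \<Longrightarrow> q i $ 1 \<ge> 0"
  using q_pos[of i] q_m X by (cases "i = m") auto

lemma q_upper: "1 \<le> i \<Longrightarrow> i \<le> m \<Longrightarrow> q i $ 2 > 0"
  using q_neg[of "i - 1"] f_sign(1)[of "q (i - 1)"] q_Suc[of "i - 1"] by simp

lemma q_lower: "Suc (Suc m) \<le> i \<Longrightarrow> i \<le> N \<Longrightarrow> q i $ 2 < 0"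
  using q_pos[of "i - 1"] f_sign(2)[of "q (i - 1)"] q_Suc[of "i - 1"] by simp

lemma V: "V $ 1 < 0" "V $ 2 \<le> 0"
proof -
  show "V $ 1 < 0" using q_neg[of 0] m by (simp add: q_0)
  have "inv f V = (inv f ^^ \<l>) X"
    unfolding V_pt_def m_def[symmetric] m(2) by simp
  then have "inv f V $ 1 \<ge> 0" using bwd_time(2) by simp
  then show "V $ 2 \<le> 0" using f_sign(1)[of "inv f V"] by (simp add: not_less[symmetric])
qed

lemma Z: "Z $ 1 \<le> 0" "Z $ 2 < 0"
  using fwd_time(2) q_lower[of N] N by (simp_all add: q_N[symmetric] N_def q_right)

text \<open>The orbit of \<open>V\<close> under the left piece alone agrees with that of
  \<open>f\<close> up to index \<open>Suc m\<close>, since all points before stay in the left half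
  plane.\<close>

lemma left_arc:
  assumes "i \<le> m"
  shows "j \<le> Suc m \<Longrightarrow> j \<noteq> i \<Longrightarrow> j \<noteq> Suc i \<Longrightarrow> orient (q i) (q (Suc i)) (q j) < 0"
    and "orient (q i) (q (Suc i)) 0 < 0"
proof -
  let ?p = "\<lambda>k. (affine_piece \<tau>L \<delta>L ^^ k) V"
  have eq: "?p k = q k" if "k \<le> Suc m" for k
    using that
  proof (induction k)
    case (Suc k)
    then show ?case using f_L[of "q k"] q_nonpos[of k] by (simp add: q_Suc)
  qed (simp add: q_0)
  have "?p (Suc (Suc m)) = affine_piece \<tau>L \<delta>L (q (Suc m))"
    using eq[of "Suc m"] by simp
  then have below: "?p (Suc (Suc m)) $ 2 < 0"
    using \<delta> \<beta> q_Sm by simp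
  interpret affine_arc "affine_piece \<tau>L \<delta>L" ?p m \<delta>L
  proof
    show "?p m $ 1 = 0" "?p (Suc m) $ 1 > 0" "?p (Suc m) $ 2 = 0"
      using eq[of m] eq[of "Suc m"] X q_m q_Sm \<beta> by simp_all
    show "1 \<le> k \<Longrightarrow> k \<le> m \<Longrightarrow> ?p k $ 2 > 0" for k
      using eq[of k] q_upper[of k] by simp
  qed (use \<delta> m V below in \<open>simp_all add: orient_affine_piece\<close>)
  show "orient (q i) (q (Suc i)) (q j) < 0" if "j \<le> Suc m" "j \<noteq> i" "j \<noteq> Suc i"
    using edge_point[OF assms that] eq[of i] eq[of "Suc i"] eq[of j] assms that by simp
  show "orient (q i) (q (Suc i)) 0 < 0"
    using edge_0[OF assms] eq[of i] eq[of "Suc i"] assms by simp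
qed

text \<open>Exchanging the coordinates and reversing time turns the right-hand part of the orbit into an
  arc of the same shape as the left-hand part.\<close>

definition swap :: "real^2 \<Rightarrow> real^2" where
  "swap x = vector [x $ 2, x $ 1]"

text \<open>The inverse of the right affine piece, conjugated by \<open>swap\<close>.\<close>

definition swap_inv :: "real^2 \<Rightarrow> real^2" where
  "swap_inv x = vector [x $ 2 - 1 + \<tau>R * x $ 1 / \<delta>R, - x $ 1 / \<delta>R]"

lemma swap_nth [simp]: "swap x $ 1 = x $ 2" "swap x $ 2 = x $ 1"
  by (simp_all add: swap_def vector_2)

lemma swap_inv_nth: "swap_inv x $ 1 = x $ 2 - 1 + \<tau>R * x $ 1 / \<delta>R" "swap_inv x $ 2 = - x $ 1 / \<delta>R"
  by (simp_all add: swap_inv_def vector_2)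

lemma swap_inv_swap: "x $ 1 \<ge> 0 \<Longrightarrow> swap_inv (swap (f x)) = swap x"
  using \<delta> by (simp add: f_R vec_eq_iff forall_2 swap_inv_nth field_simps)

lemma orient_swap: "orient (swap a) (swap b) (swap c) = orient b a c"
  by (simp add: orient_def algebra_simps)

lemma orient_swap_inv: "orient (swap_inv a) (swap_inv b) (swap_inv c) = (1 / \<delta>R) * orient a b c"
  using \<delta> by (simp add: orient_def swap_inv_nth field_simps)

text \<open>Index \<open>k\<close> of the reversed arc is index \<open>N - k\<close> of the orbit,
  and \<open>swap Z\<close> lies in the quadrant required of a start. The reflection reverses
  orientations and the time reversal exchanges the ends of each edge, so the sign is the same in the
  end.\<close>

lemma right_arc:
  assumes "m \<le> i" "i < N"
  shows "m \<le> j \<Longrightarrow> j \<le> N \<Longrightarrow> j \<noteq> i \<Longrightarrow> j \<noteq> Suc i \<Longrightarrow> orient (q i) (q (Suc i)) (q j) < 0"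
    and "orient (q i) (q (Suc i)) 0 < 0"
proof -
  let ?p = "\<lambda>k. (swap_inv ^^ k) (swap Z)"
  have eq: "?p k = swap (q (N - k))" if "k \<le> r" for k
    using that
  proof (induction k)
    case (Suc k)
    then have s: "N - k = Suc (N - Suc k)" by (simp add: N_def)
    have "q (N - Suc k) $ 1 \<ge> 0" using Suc.prems by (intro q_nonneg) (auto simp: N_def)
    then have "swap_inv (swap (q (N - k))) = swap (q (N - Suc k))"
      unfolding s q_Suc by (rule swap_inv_swap)
    then show ?case using Suc by simp
  qed (simp add: q_N)
  define M where "M = r - 1"
  have rM: "M \<ge> 1" "r = Suc M" "N = Suc (M + m)" using fwd_time(1) by (auto simp: M_def N_def)
  have pM: "?p M = swap (q (Suc m))" using eq[of M] rM by simp
  have pSM: "?p (Suc M) = swap X" using eq[of "Suc M"] rM by (simp add: q_m)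
  \<comment> \<open>The preimage of \<open>X\<close> under the right piece alone, which lies to the
    left of the switching line.\<close>
  have "?p (Suc (Suc M)) = swap_inv (swap X)"
    using pSM by simp
  then have below: "?p (Suc (Suc M)) $ 2 < 0"
    using \<delta> \<beta> by (simp add: swap_inv_nth X)
  interpret affine_arc swap_inv ?p M "1 / \<delta>R"
  proof
    show "?p M $ 1 = 0" "?p (Suc M) $ 1 > 0" "?p (Suc M) $ 2 = 0"
      unfolding pM pSM using X q_Sm \<beta> by simp_all
    show "?p k $ 2 > 0" if "1 \<le> k" "k \<le> M" for k
      using eq[of k] q_pos[of "N - k"] that rM by simp
  qed (use \<delta> rM Z below in \<open>simp_all add: orient_swap_inv\<close>)
  define k where "k = N - Suc i"
  have k: "k \<le> M" "N - k = Suc i" "N - Suc k = i" using assms rM by (auto simp: k_def)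
  then have pk: "?p k = swap (q (Suc i))" "?p (Suc k) = swap (q i)"
    using eq[of k] eq[of "Suc k"] rM by simp_all
  show "orient (q i) (q (Suc i)) (q j) < 0" if "m \<le> j" "j \<le> N" "j \<noteq> i" "j \<noteq> Suc i"
  proof -
    have "?p (N - j) = swap (q j)" using eq[of "N - j"] that by (simp add: N_def)
    moreover have "orient (?p k) (?p (Suc k)) (?p (N - j)) < 0"
      using k that rM assms by (intro edge_point) auto
    ultimately show ?thesis unfolding pk by (simp add: orient_swap)
  qed
  have "swap 0 = 0" by (simp add: vec_eq_iff forall_2)
  then show "orient (q i) (q (Suc i)) 0 < 0"
    using edge_0[OF k(1)] orient_swap[of "q (Suc i)" "q i" 0] unfolding pk by simp
qed

lemma image_switching_line: "f ` switching_line = {x. x $ 2 = 0}"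
proof (intro equalityI subsetI)
  fix x :: "real^2" assume "x \<in> {x. x $ 2 = 0}"
  then have "inv f x \<in> switching_line"
    using f_sign(3)[of "inv f x"] by (simp add: switching_line_def)
  then show "x \<in> f ` switching_line" by (metis f_inv image_eqI)
qed (use f_sign(3) in \<open>auto simp: switching_line_def\<close>)

lemma lineI: "(1 - t) *\<^sub>R a + t *\<^sub>R b \<in> line a b"
  unfolding line_def affine_hull_2 
  by (intro CollectI exI[of _ "1 - t"] exI[of _ t]) simp

lemma lineE:
  assumes "x \<in> line a b"
  obtains t where "x = (1 - t) *\<^sub>R a + t *\<^sub>R b"
proof -
  obtain u v where "x = u *\<^sub>R a + v *\<^sub>R b" "u + v = 1"
    using assms unfolding line_def affine_hull_2 by auto
  moreover from this have "u = 1 - v" by simp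
  ultimately show ?thesis using that[of v] by simp
qed

definition "\<sigma> = V $ 2 / (V $ 2 - q 1 $ 2)"

lemma \<sigma>: "0 \<le> \<sigma>" "\<sigma> < 1"
  using V q_upper[of 1] m unfolding \<sigma>_def by (auto simp: divide_simps)

lemma U_eq: "U = (1 - \<sigma>) *\<^sub>R V + \<sigma> *\<^sub>R q 1"
proof -
  have fV: "f V = q 1" by (simp add: q_Suc[of 0, simplified] q_0)
  have pos: "q 1 $ 2 > 0" using q_upper[of 1] m by simp
  let ?u = "(1 - \<sigma>) *\<^sub>R V + \<sigma> *\<^sub>R q 1"
  have "?u $ 2 = V $ 2 - \<sigma> * (V $ 2 - q 1 $ 2)" by (simp add: algebra_simps)
  also have "\<dots> = 0" using pos V by (simp add: \<sigma>_def)
  finally have u: "?u \<in> line V (q 1) \<inter> {x. x $ 2 = 0}" using lineI by auto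
  have "line V (q 1) = line (q 1) V" unfolding line_def by (simp add: insert_commute)
  then have "\<exists>!x. x \<in> line V (q 1) \<inter> {x. x $ 2 = 0}"
    using line_meets_axis_unique[of "q 1" 2 V] pos V by simp
  then show ?thesis
    unfolding U_pt_def image_switching_line fV using u by (rule the1_equality)
qed

lemma U: "U $ 1 < 0" "U $ 2 = 0"
proof -
  have "(1 - \<sigma>) * V $ 1 < 0" using \<sigma> V by (simp add: mult_pos_neg)
  moreover have "\<sigma> * q 1 $ 1 \<le> 0" using \<sigma> q_nonpos[of 1] m by (simp add: mult_nonneg_nonpos)
  ultimately show "U $ 1 < 0" unfolding U_eq by simp
  have "V $ 2 - q 1 $ 2 < 0" using V q_upper[of 1] m by simp
  then show "U $ 2 = 0" unfolding U_eq by (simp add: \<sigma>_def field_simps)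
qed

lemma f_U: "f U = (1 - \<sigma>) *\<^sub>R q 1 + \<sigma> *\<^sub>R q 2"
proof -
  have "f U = affine_piece \<tau>L \<delta>L ((1 - \<sigma>) *\<^sub>R V + \<sigma> *\<^sub>R q 1)"
    using f_L[of U] U by (simp add: U_eq)
  also have "\<dots> = (1 - \<sigma>) *\<^sub>R f V + \<sigma> *\<^sub>R f (q 1)"
    using f_L[of V] f_L[of "q 1"] V q_nonpos[of 1] m by (simp only: affine_piece_lincomb) simp
  finally show ?thesis using q_Suc[of 0] q_Suc[of 1] by (simp add: q_0 numeral_2_eq_2)
qed

text \<open>\<open>U\<close> lies on the edge from \<open>V\<close> to \<open>f V\<close> before its
  end, so cutting that edge at \<open>U\<close> changes no sign.\<close>

lemma orient_U: "orient U (q 1) w = (1 - \<sigma>) * orient V (q 1) w"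
  unfolding U_eq by (simp add: orient_def algebra_simps)

definition "y = q (N - 1) $ 1 / (q (N - 1) $ 1 - Z $ 1)"

lemma last_pos: "q (N - 1) $ 1 > 0"
  using q_pos[of "N - 1"] N by simp

lemma y: "0 < y" "y \<le> 1"
  using last_pos Z unfolding y_def by (auto simp: divide_simps)

lemma Y_eq: "Y = (1 - y) *\<^sub>R q (N - 1) + y *\<^sub>R Z" and Y: "Y $ 1 = 0"
proof -
  have "f (q (N - 1)) = Z" using q_Suc[of "N - 1"] q_N N by simp
  then have inv_Z: "inv f Z = q (N - 1)" by (metis inv_f)
  let ?y = "(1 - y) *\<^sub>R q (N - 1) + y *\<^sub>R Z"
  have "?y $ 1 = q (N - 1) $ 1 - y * (q (N - 1) $ 1 - Z $ 1)" by (simp add: algebra_simps)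
  also have "\<dots> = 0" using last_pos Z by (simp add: y_def)
  finally have u: "?y \<in> line (q (N - 1)) Z \<inter> {x. x $ 1 = 0}" using lineI by auto
  have "line Z (q (N - 1)) = line (q (N - 1)) Z" unfolding line_def by (simp add: insert_commute)
  then show "Y = ?y"
    unfolding Y_pt_def inv_Z switching_line_def
    using the1_equality[OF line_meets_axis_unique[OF last_pos Z(1)] u] by simp
  then show "Y $ 1 = 0" using u by simp
qed

text \<open>The value beyond \<open>N\<close> makes the closing edge from \<open>Z\<close> back to
  \<open>U\<close> the edge with index \<open>N\<close>.\<close>

definition "p k = (if k = 0 \<or> k > N then U else q k)"

lemma p_simps: "p 0 = U" "p (Suc N) = U" "1 \<le> k \<Longrightarrow> k \<le> N \<Longrightarrow> p k = q k"
  by (simp_all add: p_def)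

lemma closed_chain_vertices:
  "closed_chain (\<Omega>_vertices f X) = (\<Union>k\<le>N. closed_segment (p k) (p (Suc k)))"
proof (rule closed_chain_conv)
  show "length (\<Omega>_vertices f X) = Suc N"
    using m by (simp add: \<Omega>_vertices_def m_def[symmetric] N_def)
  show "\<Omega>_vertices f X ! k = p k" if "k \<le> N" for k
  proof -
    consider "k = 0" | "1 \<le> k" "k < m" | "m \<le> k" "k < N" | "k = N"
      using \<open>k \<le> N\<close> by linarith
    then show ?thesis
    proof cases
      case 1
      then show ?thesis by (simp add: \<Omega>_vertices_def p_simps)
    next
      case 2
      then have "Suc (m - Suc k) = m - k" "k - Suc 0 < m - Suc 0" by auto
      then have "\<Omega>_vertices f X ! k = (inv f ^^ (m - k)) X"
        using 2 unfolding \<Omega>_vertices_def m_def[symmetric]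
        by (simp add: nth_append nth_Cons' rev_nth del: funpow.simps)
      then show ?thesis using 2 N by (simp add: p_simps q_left)
    next
      case 3
      then have "\<not> k - Suc 0 < m - Suc 0" "k - m < r" using m(1) by (auto simp: N_def)
      then have "\<Omega>_vertices f X ! k = (f ^^ (k - m)) X"
        unfolding \<Omega>_vertices_def m_def[symmetric] using m(1) 3
        by (simp add: nth_append nth_Cons' N_def)
      then show ?thesis using 3 m q_right[of "k - m"] by (simp add: p_simps)
    next
      case 4
      then have "\<not> m + r - Suc 0 < m - Suc 0" using m(1) by auto
      with 4 show ?thesis
        unfolding \<Omega>_vertices_def m_def[symmetric] using m(1) N
        by (simp add: nth_append nth_Cons' N_def p_def q_right Z_pt_def)
    qed
  qed
qed (simp add: p_simps)

lemma upper_edge: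
  assumes "i \<le> m"
  shows "orient (p i) (p (Suc i)) w = (if i = 0 then 1 - \<sigma> else 1) * orient (q i) (q (Suc i)) w"
  using assms N orient_U by (simp add: p_simps q_0)

lemma lower_edge: "m < i \<Longrightarrow> i < N \<Longrightarrow> orient (p i) (p (Suc i)) w = orient (q i) (q (Suc i)) w"
  by (simp add: p_simps)

lemma upper_edge_sign:
  assumes "i \<le> m"
  shows "orient (p i) (p (Suc i)) w < 0 \<longleftrightarrow> orient (q i) (q (Suc i)) w < 0"
    and "orient (p i) (p (Suc i)) w \<le> 0 \<longleftrightarrow> orient (q i) (q (Suc i)) w \<le> 0"
  unfolding upper_edge[OF assms] using \<sigma> by (auto simp: mult_less_0_iff mult_le_0_iff)

lemma left_arc_le:
  assumes "i \<le> m" "j \<le> Suc m"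
  shows "orient (q i) (q (Suc i)) (q j) \<le> 0"
  using left_arc(1)[OF assms] by (cases "j = i \<or> j = Suc i") (auto simp: less_imp_le)

lemma right_arc_le:
  assumes "m \<le> i" "i < N" "m \<le> j" "j \<le> N"
  shows "orient (q i) (q (Suc i)) (q j) \<le> 0"
  using right_arc(1)[OF assms] by (cases "j = i \<or> j = Suc i") (auto simp: less_imp_le)

lemma left_arc_U:
  assumes "i \<le> m"
  shows "orient (q i) (q (Suc i)) U \<le> 0"
  using left_arc_le[OF assms, of 0] left_arc_le[OF assms, of 1] \<sigma>
  unfolding U_eq orient_convex2 q_0 by (simp add: add_nonpos_nonpos mult_nonneg_nonpos)

sublocale fan_polygon p m N
proof
  show "Suc m < N" using N by simp
  show "p 0 $ 1 < 0" "p 0 $ 2 = 0" "p (Suc N) = p 0" by (simp_all add: p_simps U)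
  show "p (Suc m) $ 1 > 0" "p (Suc m) $ 2 = 0" using N \<beta> by (simp_all add: p_simps q_Sm)
  show "p N $ 1 \<le> 0" "p N $ 2 < 0" using N Z by (simp_all add: p_simps q_N)
  show "orient (p i) (p (Suc i)) 0 < 0" if "i \<le> N" for i
  proof -
    consider "i \<le> m" | "m < i" "i < N" | "i = N" using \<open>i \<le> N\<close> by linarith
    then show ?thesis
    proof cases
      case 1
      then show ?thesis by (simp add: upper_edge_sign left_arc)
    next
      case 2
      then show ?thesis by (simp add: lower_edge right_arc)
    next
      case 3
      then show ?thesis using N U Z by (simp add: p_simps orient_0 q_N mult_neg_neg)
    qed
  qed
  show "orient (p i) (p (Suc i)) (p j) \<le> 0" if "i \<le> m" "j \<le> Suc m" for i j
    unfolding upper_edge_sign[OF \<open>i \<le> m\<close>]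
    using that left_arc_le[of i j] left_arc_U[of i] N by (cases "j = 0") (simp_all add: p_simps)
  show "orient (p i) (p (Suc i)) (p j) \<le> 0" if "m < i" "i < N" "m < j" "j \<le> N" for i j
    using that right_arc_le[of i j] by (simp add: p_simps)
  show "p j $ 2 \<ge> 0" if "j \<le> Suc m" for j
  proof -
    consider "j = 0" | "1 \<le> j" "j \<le> m" | "j = Suc m" using \<open>j \<le> Suc m\<close> by linarith
    then show ?thesis
      using U q_upper[of j] q_Sm N by cases (auto simp: p_simps less_imp_le)
  qed
  show p2: "p j $ 2 \<le> 0" if "m < j" "j \<le> N" for j
    using that q_Sm q_lower[of j] by (cases "j = Suc m") (auto simp: p_simps less_imp_le)
  show "orient (p j) (p N) 0 \<le> 0" if "m < j" "j \<le> N" for j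
  proof (cases "j = N")
    case False
    then have "q j $ 1 > 0" "q j $ 2 \<le> 0" using that p2[of j] by (auto simp: q_pos p_simps)
    then have "q j $ 1 * Z $ 2 \<le> 0" "q j $ 2 * Z $ 1 \<ge> 0"
      using Z by (auto simp: mult_nonneg_nonpos mult_nonpos_nonpos)
    then show ?thesis using that N by (simp add: p_simps orient_0 q_N)
  qed (simp add: orient_0)
qed

lemma \<Omega>_eq: "\<Omega> f X = chain \<union> inside chain"
  unfolding \<Omega>_def closed_chain_vertices chain_def ..

end

section \<open>Consequences of the three geometric conditions\<close>

locale trapped_orbit = returning_orbit +
  assumes cond_i: "Y_pt f X $ 2 > inv f (U_pt f X) $ 2"
    and cond_ii: "above_line (Z_pt f X) (line (inv f (U_pt f X)) (V_pt f X))"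
    and cond_iii: "right_of_line (Z_pt f X) (line (V_pt f X) (f (V_pt f X)))"
begin

text \<open>Condition (i) thus says that \<open>f Y\<close> lies to the right of \<open>U\<close> on
  the horizontal axis.\<close>

lemma inv_U: "inv f U $ 1 = 0" "inv f U $ 2 = U $ 1 - 1"
proof -
  show z: "inv f U $ 1 = 0" using f_sign(3)[of "inv f U"] U by simp
  have "f (inv f U) $ 1 = inv f U $ 2 + 1" by (simp add: f_L z del: f_inv)
  then show "inv f U $ 2 = U $ 1 - 1" by simp
qed

text \<open>The horizontal gap in (iii) is a positive multiple of minus the determinant, because
  \<open>V\<close> is lower than \<open>f V\<close>.\<close>

lemma Z_right_of_VfV: "orient V (q 1) Z < 0"
proof -
  have fV: "f V = q 1" by (simp add: q_Suc[of 0, simplified] q_0)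
  obtain t where "((1 - t) *\<^sub>R V + t *\<^sub>R q 1) $ 2 = Z $ 2" "((1 - t) *\<^sub>R V + t *\<^sub>R q 1) $ 1 < Z $ 1"
    using cond_iii unfolding right_of_line_def fV by (metis lineE)
  moreover define d where "d = Z $ 1 - ((1 - t) *\<^sub>R V + t *\<^sub>R q 1) $ 1"
  ultimately have d: "d > 0" "Z $ 1 = (1 - t) * V $ 1 + t * q 1 $ 1 + d"
    and Z2: "Z $ 2 = (1 - t) * V $ 2 + t * q 1 $ 2" by simp_all
  have "orient V (q 1) Z = - (q 1 $ 2 - V $ 2) * d"
    unfolding orient_def d(2) Z2 by (simp add: algebra_simps)
  moreover have "q 1 $ 2 - V $ 2 > 0" using q_upper[of 1] m V by simp
  ultimately show ?thesis using d by (simp add: mult_neg_pos)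
qed

text \<open>The left piece maps the line in (ii) to the line through \<open>U\<close> and
  \<open>f V\<close>, which contains \<open>V\<close>, and it preserves orientation;
  \<open>V\<close> lies to the left of the switching line, which fixes the sign.\<close>

lemma fZ_right_of_VfV: "orient V (q 1) (f Z) < 0"
proof -
  obtain t where "((1 - t) *\<^sub>R inv f U + t *\<^sub>R V) $ 1 = Z $ 1" "((1 - t) *\<^sub>R inv f U + t *\<^sub>R V) $ 2 < Z $ 2"
    using cond_ii unfolding above_line_def by (metis lineE)
  moreover define d where "d = Z $ 2 - ((1 - t) *\<^sub>R inv f U + t *\<^sub>R V) $ 2"
  ultimately have d: "d > 0" "Z $ 2 = (1 - t) * inv f U $ 2 + t * V $ 2 + d"
    and Z1: "Z $ 1 = t * V $ 1" by (simp_all add: inv_U)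
  have "orient (inv f U) V Z = V $ 1 * d"
    unfolding orient_def d(2) Z1 by (simp add: inv_U algebra_simps)
  then have "orient (inv f U) V Z < 0" using V d by (simp add: mult_neg_pos)
  then have "\<delta>L * orient (inv f U) V Z < 0" using \<delta> by (simp add: mult_pos_neg)
  moreover have "orient (f (inv f U)) (f V) (f Z) = \<delta>L * orient (inv f U) V Z"
    using V Z by (simp add: f_L inv_U orient_affine_piece del: f_inv)
  moreover have "f V = q 1" by (simp add: q_Suc[of 0, simplified] q_0)
  ultimately have "orient U (q 1) (f Z) < 0" by simp
  then show ?thesis unfolding orient_U using \<sigma> by (simp add: mult_less_0_iff)
qed

text \<open>The segment from \<open>Z\<close> to \<open>q k\<close> meets the horizontal axis strictly between \<open>U\<close> and the origin.\<close>

lemma Z_right_of_left_edge: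
  assumes "k < m"
  shows "orient (q k) (q (Suc k)) Z < 0"
proof (cases "k = 0")
  case True
  then show ?thesis using Z_right_of_VfV by (simp add: q_0)
next
  case False
  then have qk: "q k $ 2 > 0" using q_upper assms by simp
  define t where "t = q k $ 2 / (q k $ 2 - Z $ 2)"
  have t: "0 < t" "t < 1" using qk Z by (simp_all add: t_def)
  define T where "T = (1 - t) *\<^sub>R q k + t *\<^sub>R Z"
  have "T $ 2 = q k $ 2 - t * (q k $ 2 - Z $ 2)" by (simp add: T_def algebra_simps)
  also have "\<dots> = 0" using qk Z by (simp add: t_def)
  finally have T2: "T $ 2 = 0" .
  have T1: "T $ 1 \<le> 0"
    unfolding T_def using t q_nonpos[of k] assms Z
    by (simp add: add_nonpos_nonpos mult_nonneg_nonpos)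
  obtain c where c: "c \<ge> 0" "T = c *\<^sub>R U"
    using left_axis[OF T2 T1] by (auto simp: p_simps)
  have "(1 - t) * orient V (q 1) (q k) \<le> 0"
    using left_arc_le[of 0 k] t assms by (simp add: q_0 mult_nonneg_nonpos)
  moreover have "t * orient V (q 1) Z < 0" using Z_right_of_VfV t by (simp add: mult_pos_neg)
  ultimately have "orient V (q 1) T < 0" unfolding T_def orient_convex2 by linarith
  moreover have "orient V (q 1) U = 0" unfolding U_eq orient_convex2 by simp
  moreover have "orient V (q 1) 0 < 0" using left_arc(2)[of 0] by (simp add: q_0)
  ultimately have c1: "c < 1" unfolding c(2) orient_scale by (simp add: mult_less_0_iff)
  have "(1 - c) * orient (q k) (q (Suc k)) 0 < 0"
    using c1 left_arc(2)[of k] assms by (simp add: mult_pos_neg)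
  moreover have "c * orient (q k) (q (Suc k)) U \<le> 0"
    using c left_arc_U[of k] assms by (simp add: mult_nonneg_nonpos)
  ultimately have "orient (q k) (q (Suc k)) T < 0" unfolding c(2) orient_scale by linarith
  then show ?thesis unfolding T_def orient_convex2 using t by (simp add: mult_less_0_iff)
qed

text \<open>An edge after the first one is the image of its predecessor under the left piece, which
  also acts on \<open>Z\<close>; the first edge is where (ii) enters.\<close>

lemma fZ_right_of_left_edge:
  assumes "i \<le> m"
  shows "orient (q i) (q (Suc i)) (f Z) < 0"
proof (cases i)
  case 0
  then show ?thesis using fZ_right_of_VfV by (simp add: q_0)
next
  case (Suc k)
  then have "orient (q i) (q (Suc i)) (f Z) = \<delta>L * orient (q k) (q (Suc k)) Z"
    using f_L[of "q k"] f_L[of "q (Suc k)"] f_L[of Z] q_nonpos[of k] q_nonpos[of "Suc k"] Z assms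
    by (simp add: q_Suc[of k] q_Suc[of "Suc k"] orient_affine_piece)
  then show ?thesis using Z_right_of_left_edge[of k] \<delta> Suc assms by (simp add: mult_pos_neg)
qed

sublocale fan_map p m N \<tau>L \<delta>L \<tau>R \<delta>R \<sigma> y f Y
proof
  show "0 < \<delta>L" "0 < \<delta>R" "f = bcnf \<tau>L \<delta>L \<tau>R \<delta>R" "1 \<le> m" by (fact \<delta> f_def m)+
  show "f (p k) = p (Suc k)" if "1 \<le> k" "k < N" for k
    using that by (simp add: p_simps q_Suc)
  show "0 \<le> \<sigma>" "\<sigma> \<le> 1" using \<sigma> by simp_all
  show "f (p 0) = (1 - \<sigma>) *\<^sub>R p 1 + \<sigma> *\<^sub>R p 2"
    using N m by (simp add: p_simps f_U)
  show "p k $ 1 \<le> 0" if "k \<le> m" for k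
    using that U q_nonpos[of k] N by (cases "k = 0") (simp_all add: p_simps)
  show "p k $ 1 \<ge> 0" if "m \<le> k" "k < N" for k
    using that q_nonneg[of k] m by (simp add: p_simps)
  show "p (N - 1) $ 1 > 0" using last_pos N by (simp add: p_simps)
  show "p (Suc m) $ 1 > 1" using N \<beta> by (simp add: p_simps q_Sm)
  show "orient (p i) (p (Suc i)) (p (N - 1)) \<le> 0" if "m \<le> i" "Suc i < N" for i
    using that m N right_arc_le[of i "N - 1"] by (simp add: p_simps)
  show "orient (p i) (p (Suc i)) (p N) < 0" if "m \<le> i" "Suc i < N" for i
    using that m N right_arc(1)[of i N] by (simp add: p_simps)
  show "orient (p i) (p (Suc i)) (f (p N)) < 0" if "i \<le> m" for i
    using that fZ_right_of_left_edge[of i] N upper_edge_sign(1)[of i "f Z"] by (simp add: p_simps(3)[of N] q_N)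
  show "0 < y" "y \<le> 1" by (fact y)+
  show "Y = (1 - y) *\<^sub>R p (N - 1) + y *\<^sub>R p N" using Y_eq N by (simp add: p_simps q_N)
  show "Y $ 1 = 0" by (fact Y)
  show "p 0 $ 1 < Y $ 2 + 1" using cond_i by (simp add: p_simps inv_U)
qed

end

theorem proposition6p5:
  fixes \<tau>L \<tau>R \<delta>L \<delta>R \<beta> :: real
    and f :: "real^2 \<Rightarrow> real^2" and X :: "real^2"
  assumes "\<delta>L > 0" and "\<delta>R > 0"
    and "f = bcnf \<tau>L \<delta>L \<tau>R \<delta>R"
    and "\<beta> > 0" and "X = vector [0, \<beta>]"
    and "\<exists>i\<ge>1. (f ^^ i) X $ 1 \<le> 0"
    and "\<exists>j\<ge>1. (inv f ^^ j) X $ 1 \<ge> 0"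
    and "Y_pt f X $ 2 > inv f (U_pt f X) $ 2"
    and "above_line (Z_pt f X) (line (inv f (U_pt f X)) (V_pt f X))"
    and "right_of_line (Z_pt f X) (line (V_pt f X) (f (V_pt f X)))"
  shows "f ` \<Omega> f X \<subseteq> \<Omega> f X \<and>
    (\<forall>\<epsilon>>0. \<exists>T. T \<subset> \<Omega> f X \<and> trapping_region f T \<and>
       hausdorff_dist (\<Omega> f X) T \<le> ereal \<epsilon>)"
proof -
  interpret trapped_orbit \<tau>L \<tau>R \<delta>L \<delta>R \<beta> f X
    using assms by unfold_locales
  show ?thesis by (rule forward_invariant_and_trapping[folded \<Omega>_eq])
qed

end
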